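(* Let $\{a(x)\}_{x \geq 1}$ be a sequence of distinct integers, and for $N \geq 1$ let $A_N = \{a(1), \dots, a(N)\}$. Suppose there exists a fixed constant $\varepsilon > 0$ such that $$E(A_N) \ll N^{3-\varepsilon} \qquad \text{as } N \to \infty.$$ Then for almost all $\alpha \in \mathbb{R}$ (with respect to Lebesgue measure) one has $$R_2\big([-s,s],\alpha,N\big) \to 2s \qquad \text{as } N \to \infty \quad \text{for all } s \geq 0. \qquad ( * )$$ Moreover, if in addition $a(x) \ll x^d$ for some $d>0$, then the Hausdorff dimension of the set of $\alpha$ for which $( * )$ fails is at most $$\frac{d+3-\varepsilon}{d+3}.$$
   Context: For a real number $t$, $\|t\|$ denotes the distance from $t$ to the nearest integer and $\langle t \rangle$ denotes the fractional part of $t$. For a finite set $A$ of real numbers, the additive energy is $E(A) = \#\{(a,b,c,d) \in A^4 : a+b = c+d\}$. For the fixed sequence $\{a(x)\}_{x\geq 1}$, $\alpha \in \mathbb{R}$, $s \geq 0$ and $N \geq 1$, the pair correlation function is $$R_2\big([-s,s],\alpha,N\big) = \frac{1}{N}\,\#\Big\{1 \leq j \neq k \leq N : \big\|\langle \alpha a(j)\rangle - \langle \alpha a(k)\rangle\big\| \leq \frac{s}{N}\Big\}.$$ *)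

theory Defs
  imports "HOL-Analysis.Analysis" "HOL-Library.Landau_Symbols"
begin

definition additive_energy :: "'a::plus set \<Rightarrow> nat" where
  "additive_energy A =
     card {(a, b, c, d). a \<in> A \<and> b \<in> A \<and> c \<in> A \<and> d \<in> A \<and> a + b = c + d}"

definition dist_nearest_int :: "real \<Rightarrow> real" where
  "dist_nearest_int t = infdist t \<int>"

text \<open>
  The sequence is indexed from 1 (its value at 0 is never used), and the pairs
  \<open>(j, k)\<close> are ordered.
\<close>

definition pair_correlation :: "(nat \<Rightarrow> int) \<Rightarrow> real \<Rightarrow> real \<Rightarrow> nat \<Rightarrow> real" where
  "pair_correlation a s \<alpha> N =
     real (card {(j, k). j \<in> {1..N} \<and> k \<in> {1..N} \<and> j \<noteq> k \<and>
       dist_nearest_int (frac (\<alpha> * of_int (a j)) - frac (\<alpha> * of_int (a k))) \<le> s / real N})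
     / real N"

definition poissonian_pair_correlation :: "(nat \<Rightarrow> int) \<Rightarrow> real \<Rightarrow> bool" where
  "poissonian_pair_correlation a \<alpha> \<longleftrightarrow>
     (\<forall>s\<ge>0. (\<lambda>N. pair_correlation a s \<alpha> N) \<longlonglongrightarrow> 2 * s)"

text \<open>
  The power \<open>diam(U)\<^sup>s\<close> in the definition of Hausdorff measure. The case \<open>s = 0\<close> is separate
  because \<open>0 powr 0 = 0\<close>, whereas the convention here is \<open>diam(U)\<^sup>0 = 1\<close> for nonempty \<open>U\<close>, so
  that the zero-dimensional Hausdorff measure is the counting measure.
\<close>

definition diameter_power :: "real \<Rightarrow> 'a::metric_space set \<Rightarrow> real" where
  "diameter_power s U = (if U = {} then 0 else if s = 0 then 1 else diameter U powr s)"

text \<open>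
  Boundedness of the covering sets is required explicitly because \<^const>\<open>diameter\<close> is
  real-valued and has no meaningful value on unbounded sets.
\<close>

definition hausdorff_premeasure :: "real \<Rightarrow> real \<Rightarrow> 'a::metric_space set \<Rightarrow> ennreal" where
  "hausdorff_premeasure s \<delta> S =
     (INF U \<in> {U :: nat \<Rightarrow> 'a set. S \<subseteq> (\<Union>i. U i) \<and>
                 (\<forall>i. bounded (U i) \<and> diameter (U i) \<le> \<delta>)}.
        \<Sum>i. ennreal (diameter_power s (U i)))"

definition hausdorff_measure :: "real \<Rightarrow> 'a::metric_space set \<Rightarrow> ennreal" where
  "hausdorff_measure s S = (SUP \<delta> \<in> {0<..}. hausdorff_premeasure s \<delta> S)"

definition hausdorff_dim :: "'a::metric_space set \<Rightarrow> ereal" where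
  "hausdorff_dim S = (INF s \<in> {s. 0 \<le> s \<and> hausdorff_measure s S = 0}. ereal s)"

end

theory Submission
  imports Defs "HOL-Probability.Probability" "HOL-Real_Asymp.Real_Asymp"
begin

text \<open>
  The count of close pairs is a sum of indicators of the sets of those \<open>\<alpha>\<close> for which
  \<open>\<parallel>v\<alpha>\<parallel> \<le> s/N\<close>, one for each difference \<open>v\<close>. The sets for \<open>v\<close> and \<open>w\<close> have covariance at most
  \<open>(2s/N) gcd(v,w)/max(v,w)\<close>, so the variance is controlled by a GCD sum weighted by the numbers
  \<open>r(v)\<close> of representations as a difference. Bounding \<open>gcd(v,w)/max(v,w)\<close> by
  \<open>gcd(v,w)/sqrt(vw)\<close> turns the sum into \<open>\<parallel>c * r\<parallel>\<^sup>2\<close> for the multiplicative convolution with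
  \<open>c(n) = 1/sqrt n\<close>; iterating Cauchy-Schwarz in the form
  \<open>\<parallel>c * r\<parallel>\<^sup>2 \<le> \<parallel>r\<parallel> \<parallel>c * c * r\<parallel>\<close> bounds it by \<open>N\<^sup>\<kappa> \<parallel>r\<parallel>\<^sup>2\<close>, i.e. by \<open>N\<^sup>\<kappa>\<close> times the energy.
  Hence the deviation of the pair correlation at \<open>N\<close> has measure at most \<open>N powr (\<kappa> - \<epsilon>)\<close>, and
  Borel-Cantelli along \<open>N = k\<^sup>b\<close>, together with monotonicity in \<open>s\<close> and \<open>N\<close>, gives the first claim.
  If \<open>a(x)\<close> is of size \<open>x\<^sup>d\<close>, the pair correlation is stable on intervals of length \<open>N powr (- d - 1)\<close>,
  so the deviation sets are covered by few such intervals, whose powers of diameters are summable.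
\<close>

section \<open>GCD sums\<close>

definition dirichlet_square :: "(nat \<Rightarrow> real) \<Rightarrow> nat \<Rightarrow> real" where
  "dirichlet_square c n = (\<Sum>d | d dvd n. c d * c (n div d))"

text \<open>The squared norm of the Dirichlet convolution of c with r, with the square expanded. The
  solutions of n v = m w are n = l w / g, m = l v / g with g = gcd v w, so for c n = 1 / sqrt n each
  l contributes g / (l sqrt (v w)), which is how GCD sums arise.\<close>

definition gcd_form :: "nat \<Rightarrow> (nat \<Rightarrow> real) \<Rightarrow> nat set \<Rightarrow> (nat \<Rightarrow> real) \<Rightarrow> real" where
  "gcd_form T c V r =
     (\<Sum>v\<in>V. \<Sum>w\<in>V. \<Sum>n=1..T. \<Sum>m=1..T. if n * v = m * w then c n * c m * r v * r w else 0)"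

definition supported :: "nat \<Rightarrow> (nat \<Rightarrow> real) \<Rightarrow> bool" where
  "supported T c \<longleftrightarrow> (\<forall>n. 0 \<le> c n) \<and> (\<forall>n. n \<notin> {1..T} \<longrightarrow> c n = 0)"

text \<open>An inequality, since it survives truncation and convolution squares: the convolution
  square of the constant 1 is the divisor function, which satisfies d(x y) <= d(x) d(y) without
  equality in general.\<close>

definition submult :: "(nat \<Rightarrow> real) \<Rightarrow> bool" where
  "submult c \<longleftrightarrow> (\<forall>x y. x > 0 \<longrightarrow> y > 0 \<longrightarrow> c (x * y) \<le> c x * c y)"

text \<open>The pairs (d, n div d) run over all factorizations n = a b. The support of c cuts them
  down to a, b <= T, and the range up to T^2 contains every such product.\<close>

lemma sum_dirichlet_square:
  assumes "supported T c"
  shows "(\<Sum>n=1..T^2. dirichlet_square c n * f n) = (\<Sum>a=1..T. \<Sum>b=1..T. c a * c b * f (a * b))"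
proof -
  define S where "S = (SIGMA n:{1..T^2}. {d. d dvd n})"
  define S' where "S' = {x \<in> S. snd x \<in> {1..T} \<and> fst x div snd x \<in> {1..T}}"
  have fin: "finite {d. d dvd n}" if "n \<in> {1..T^2}" for n
    using that by auto
  then have finS: "finite S"
    unfolding S_def by (intro finite_SigmaI) auto
  have "(\<Sum>n=1..T^2. dirichlet_square c n * f n)
      = (\<Sum>n=1..T^2. \<Sum>d | d dvd n. c d * c (n div d) * f n)"
    by (simp add: dirichlet_square_def sum_distrib_right)
  also have "\<dots> = (\<Sum>x\<in>S. c (snd x) * c (fst x div snd x) * f (fst x))"
    unfolding S_def using fin by (subst sum.Sigma) (auto intro!: sum.cong)
  also have "\<dots> = (\<Sum>x\<in>S'. c (snd x) * c (fst x div snd x) * f (fst x))"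
    using finS assms by (intro sum.mono_neutral_right) (auto simp: S'_def supported_def)
  also have "\<dots> = (\<Sum>y\<in>{1..T}\<times>{1..T}. c (fst y) * c (snd y) * f (fst y * snd y))"
  proof (rule sum.reindex_bij_witness[where i = "\<lambda>(a, b). (a * b, a)" and j = "\<lambda>(n, d). (d, n div d)"])
    fix y assume y: "y \<in> {1..T}\<times>{1..T}"
    then show "(case y of (a, b) \<Rightarrow> (a * b, a)) \<in> S'"
      using mult_mono[of "fst y" T "snd y" T]
      by (auto simp: S'_def S_def power2_eq_square)
  qed (auto simp: S'_def S_def)
  also have "\<dots> = (\<Sum>a=1..T. \<Sum>b=1..T. c a * c b * f (a * b))"
    by (subst sum.cartesian_product) (auto intro!: sum.cong)
  finally show ?thesis .
qed

lemma supported_dirichlet_square: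
  assumes "supported T c"
  shows "supported (T^2) (dirichlet_square c)"
  unfolding supported_def
proof (intro conjI allI impI)
  fix n show "0 \<le> dirichlet_square c n"
    using assms unfolding dirichlet_square_def supported_def by (intro sum_nonneg) auto
next
  fix n assume n: "n \<notin> {1..T^2}"
  have "c d * c (n div d) = 0" if "d dvd n" for d
  proof (rule ccontr)
    assume "c d * c (n div d) \<noteq> 0"
    then have "d \<in> {1..T}" "n div d \<in> {1..T}"
      using assms unfolding supported_def by (metis mult_eq_0_iff)+
    then have "d * (n div d) \<in> {1..T * T}"
      using mult_le_mono[of d T "n div d" T] mult_le_mono[of 1 d 1 "n div d"] by auto
    with n that show False by (simp add: power2_eq_square)
  qed
  then show "dirichlet_square c n = 0"
    unfolding dirichlet_square_def by (intro sum.neutral) auto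
qed

text \<open>Every divisor of x y is a product of a divisor of x and a divisor of y. Choosing one
  splitting for each divisor is injective, because the product gives the divisor back, so the sum
  for x y embeds into the product of the two sums.\<close>

lemma submult_dirichlet_square:
  assumes c: "supported T c" and sub: "submult c"
  shows "submult (dirichlet_square c)"
  unfolding submult_def
proof (intro allI impI)
  fix x y :: nat assume pos: "x > 0" "y > 0"
  have c0: "0 \<le> c n" for n using c by (simp add: supported_def)
  have "\<forall>d. \<exists>p q. d dvd x * y \<longrightarrow> d = p * q \<and> p dvd x \<and> q dvd y"
    using division_decomp by blast
  then obtain p q where pq: "\<And>d. d dvd x * y \<Longrightarrow> d = p d * q d \<and> p d dvd x \<and> q d dvd y"
    by metis
  let ?D = "{d. d dvd x * y}"
  let ?g = "\<lambda>z. (c (fst z) * c (x div fst z)) * (c (snd z) * c (y div snd z))"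
  have "dirichlet_square c (x * y) = (\<Sum>d\<in>?D. c d * c (x * y div d))"
    by (simp add: dirichlet_square_def)
  also have "\<dots> \<le> (\<Sum>d\<in>?D. ?g (p d, q d))"
  proof (rule sum_mono)
    fix d assume "d \<in> ?D"
    then have d: "d = p d * q d" "p d dvd x" "q d dvd y" using pq by auto
    have p0: "p d > 0" "q d > 0" "x div p d > 0" "y div q d > 0"
      using d pos by (auto intro!: Nat.gr0I dest: dvd_pos_nat simp: dvd_div_eq_0_iff)
    have "x * y div d = (x div p d) * (y div q d)"
      using d by (metis div_mult_div_if_dvd)
    then have "c d * c (x * y div d) \<le> (c (p d) * c (q d)) * (c (x div p d) * c (y div q d))"
      using sub p0 c0 d(1) unfolding submult_def
      by (metis (no_types, lifting) mult_mono mult_nonneg_nonneg)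
    then show "c d * c (x * y div d) \<le> ?g (p d, q d)" by (simp add: mult_ac)
  qed
  also have "\<dots> = (\<Sum>z\<in>(\<lambda>d. (p d, q d)) ` ?D. ?g z)"
  proof (rule sum.reindex_cong[symmetric, where l = "\<lambda>d. (p d, q d)"])
    show "inj_on (\<lambda>d. (p d, q d)) ?D"
      by (rule inj_onI) (metis mem_Collect_eq pq prod.inject)
  qed auto
  also have "\<dots> \<le> (\<Sum>z\<in>{d. d dvd x} \<times> {d. d dvd y}. ?g z)"
    using pq pos c0 by (intro sum_mono2) auto
  also have "\<dots> = dirichlet_square c x * dirichlet_square c y"
    unfolding dirichlet_square_def sum_product by (subst sum.cartesian_product) (auto intro!: sum.cong)
  finally show "dirichlet_square c (x * y) \<le> dirichlet_square c x * dirichlet_square c y" .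
qed

text \<open>Expanding one factor C by \<open>sum_dirichlet_square\<close> and splitting the other by
  submultiplicativity leaves the square of the sum of c a * C a, and the same argument applied to
  that sum gives \<open>sC\<close>. Each convolution square thus raises the norm sum to the fourth
  power, the source of \<open>4^j\<close> later.\<close>

lemma sum_power2_dirichlet_square:
  assumes c: "supported T c" and sub: "submult c"
  shows "(\<Sum>n=1..T^2. (dirichlet_square c n)\<^sup>2) \<le> (\<Sum>n=1..T. (c n)\<^sup>2) ^ 4"
proof -
  let ?C = "dirichlet_square c" and ?s = "\<Sum>n=1..T. (c n)\<^sup>2"
  have c0: "0 \<le> c n" for n using c by (simp add: supported_def)
  have C0: "0 \<le> ?C n" for n using supported_dirichlet_square[OF c] by (simp add: supported_def)
  have subC: "submult ?C" by (rule submult_dirichlet_square[OF c sub])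
  have sC: "(\<Sum>a=1..T. c a * ?C a) \<le> ?s\<^sup>2"
  proof -
    have "(\<Sum>a=1..T. c a * ?C a) = (\<Sum>a=1..T^2. ?C a * c a)"
    proof (rule sum.mono_neutral_cong_left)
      have "T \<le> T * T" by (cases T) auto
      then show "{1..T} \<subseteq> {1..T^2}"
        by (auto simp: power2_eq_square)
      show "\<forall>i\<in>{1..T\<^sup>2} - {1..T}. ?C i * c i = 0"
        using c by (auto simp: supported_def)
    qed auto
    also have "\<dots> = (\<Sum>a=1..T. \<Sum>b=1..T. c a * c b * c (a * b))"
      by (rule sum_dirichlet_square[OF c])
    also have "\<dots> \<le> (\<Sum>a=1..T. \<Sum>b=1..T. (c a)\<^sup>2 * (c b)\<^sup>2)"
    proof (intro sum_mono)
      fix a b assume "a \<in> {1..T}" "b \<in> {1..T}"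
      then have "c (a * b) \<le> c a * c b" using sub by (auto simp: submult_def)
      then have "(c a * c b) * c (a * b) \<le> (c a * c b) * (c a * c b)"
        using c0 by (intro mult_left_mono) auto
      then show "c a * c b * c (a * b) \<le> (c a)\<^sup>2 * (c b)\<^sup>2"
        by (simp add: power2_eq_square mult_ac)
    qed
    also have "\<dots> = ?s\<^sup>2" by (simp add: power2_eq_square sum_product)
    finally show ?thesis .
  qed
  have "(\<Sum>n=1..T^2. (?C n)\<^sup>2) = (\<Sum>n=1..T^2. ?C n * ?C n)"
    by (simp add: power2_eq_square)
  also have "\<dots> = (\<Sum>a=1..T. \<Sum>b=1..T. c a * c b * ?C (a * b))"
    by (rule sum_dirichlet_square[OF c])
  also have "\<dots> \<le> (\<Sum>a=1..T. \<Sum>b=1..T. (c a * ?C a) * (c b * ?C b))"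
  proof (intro sum_mono)
    fix a b assume "a \<in> {1..T}" "b \<in> {1..T}"
    then have "?C (a * b) \<le> ?C a * ?C b" using subC by (auto simp: submult_def)
    then have "(c a * c b) * ?C (a * b) \<le> (c a * c b) * (?C a * ?C b)"
      using c0 by (intro mult_left_mono) auto
    then show "c a * c b * ?C (a * b) \<le> (c a * ?C a) * (c b * ?C b)"
      by (simp add: mult_ac)
  qed
  also have "\<dots> = (\<Sum>a=1..T. c a * ?C a)\<^sup>2" by (simp add: power2_eq_square sum_product)
  also have "\<dots> \<le> (?s\<^sup>2)\<^sup>2"
    using sC c0 C0 by (intro power_mono sum_nonneg) auto
  finally show ?thesis by simp
qed

text \<open>For fixed v and w the equation n v = m w determines n and m from each other, so after c
  n * c m <= ((c n)^2 + (c m)^2) / 2 both halves are controlled by the square sum of c. This crude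
  bound is the base case of \<open>gcd_form_power_le\<close>.\<close>

lemma gcd_form_le:
  fixes c r :: "nat \<Rightarrow> real"
  assumes c: "supported T c" and r: "\<And>v. 0 \<le> r v" and V: "\<And>v. v \<in> V \<Longrightarrow> v > 0"
  shows "gcd_form T c V r \<le> (\<Sum>v\<in>V. r v)\<^sup>2 * (\<Sum>n=1..T. (c n)\<^sup>2)"
proof -
  let ?s = "\<Sum>n=1..T. (c n)\<^sup>2"
  have c0: "0 \<le> c n" for n using c by (simp add: supported_def)
  have half: "(\<Sum>n=1..T. \<Sum>m=1..T. if n * v = m * w then (c n)\<^sup>2 else 0) \<le> ?s"
    if "w > 0" for v w :: nat
  proof (rule sum_mono)
    fix n
    have "(\<Sum>m=1..T. if n * v = m * w then (c n)\<^sup>2 else 0)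
        = (\<Sum>m\<in>{m\<in>{1..T}. n * v = m * w}. (c n)\<^sup>2)"
      by (rule sum.inter_filter[symmetric]) simp
    also have "\<dots> \<le> (\<Sum>m\<in>{n * v div w}. (c n)\<^sup>2)"
      using that by (intro sum_mono2) auto
    finally show "(\<Sum>m=1..T. if n * v = m * w then (c n)\<^sup>2 else 0) \<le> (c n)\<^sup>2" by simp
  qed
  have inner: "(\<Sum>n=1..T. \<Sum>m=1..T. if n * v = m * w then c n * c m else 0) \<le> ?s"
    if "v > 0" "w > 0" for v w :: nat
  proof -
    have "(\<Sum>n=1..T. \<Sum>m=1..T. if n * v = m * w then c n * c m else 0)
       \<le> (\<Sum>n=1..T. \<Sum>m=1..T. (1/2) * (if n * v = m * w then (c n)\<^sup>2 else 0)
           + (1/2) * (if m * w = n * v then (c m)\<^sup>2 else 0))"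
    proof (intro sum_mono)
      fix n m
      show "(if n * v = m * w then c n * c m else 0)
         \<le> (1/2) * (if n * v = m * w then (c n)\<^sup>2 else 0) + (1/2) * (if m * w = n * v then (c m)\<^sup>2 else 0)"
        using sum_squares_bound[of "c n" "c m"] by (auto simp: field_simps)
    qed
    also have "\<dots> = (1/2) * (\<Sum>n=1..T. \<Sum>m=1..T. if n * v = m * w then (c n)\<^sup>2 else 0)
       + (1/2) * (\<Sum>n=1..T. \<Sum>m=1..T. if m * w = n * v then (c m)\<^sup>2 else 0)"
      by (simp only: sum.distrib sum_distrib_left)
    also have "(\<Sum>n=1..T. \<Sum>m=1..T. if m * w = n * v then (c m)\<^sup>2 else 0)
       = (\<Sum>m=1..T. \<Sum>n=1..T. if m * w = n * v then (c m)\<^sup>2 else 0)"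
      by (rule sum.swap)
    also have "(1/2) * (\<Sum>n=1..T. \<Sum>m=1..T. if n * v = m * w then (c n)\<^sup>2 else 0)
       + (1/2) * (\<Sum>m=1..T. \<Sum>n=1..T. if m * w = n * v then (c m)\<^sup>2 else 0) \<le> (1/2) * ?s + (1/2) * ?s"
      by (intro add_mono mult_left_mono half that) auto
    finally show ?thesis by simp
  qed
  have "gcd_form T c V r = (\<Sum>v\<in>V. \<Sum>w\<in>V. r v * r w * (\<Sum>n=1..T. \<Sum>m=1..T. if n * v = m * w then c n * c m else 0))"
    unfolding gcd_form_def sum_distrib_left by (intro sum.cong refl) auto
  also have "\<dots> \<le> (\<Sum>v\<in>V. \<Sum>w\<in>V. r v * r w * ?s)"
    using V r by (intro sum_mono mult_left_mono inner) auto
  also have "\<dots> = (\<Sum>v\<in>V. r v)\<^sup>2 * ?s"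
    by (simp add: power2_eq_square[of "sum r V"] sum_product[of r V r V] flip: sum_distrib_right)
  finally show ?thesis .
qed

lemma gcd_form_nonneg:
  fixes c r :: "nat \<Rightarrow> real"
  assumes "supported T c" "\<And>v. 0 \<le> r v"
  shows "0 \<le> gcd_form T c V r"
  using assms unfolding gcd_form_def supported_def by (intro sum_nonneg) auto

text \<open>Each value of the convolution square splits into two values of c, and the six variables
  are regrouped into the triples (v, n, m) and (w, n', m'). This is the shape that arises in
  \<open>gcd_form_square_le\<close> when two triples hit the same number.\<close>

lemma gcd_form_dirichlet_square:
  assumes c: "supported T c"
  shows "gcd_form (T^2) (dirichlet_square c) V r =
    (\<Sum>v\<in>V. \<Sum>n=1..T. \<Sum>m=1..T. \<Sum>w\<in>V. \<Sum>n'=1..T. \<Sum>m'=1..T.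
        if n * m' * v = n' * m * w then c n * c m * r v * (c n' * c m' * r w) else 0)"
proof -
  let ?C = "dirichlet_square c"
  have rot: "(\<Sum>m\<in>A. \<Sum>n\<in>A. \<Sum>k\<in>A. h m n k) = (\<Sum>k\<in>A. \<Sum>n\<in>A. \<Sum>m\<in>A. h m n k)"
    for h :: "nat \<Rightarrow> nat \<Rightarrow> nat \<Rightarrow> real" and A
  proof -
    have "(\<Sum>m\<in>A. \<Sum>n\<in>A. \<Sum>k\<in>A. h m n k) = (\<Sum>m\<in>A. \<Sum>k\<in>A. \<Sum>n\<in>A. h m n k)"
      by (intro sum.cong refl sum.swap)
    also have "\<dots> = (\<Sum>k\<in>A. \<Sum>m\<in>A. \<Sum>n\<in>A. h m n k)" by (rule sum.swap)
    also have "\<dots> = (\<Sum>k\<in>A. \<Sum>n\<in>A. \<Sum>m\<in>A. h m n k)"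
      by (intro sum.cong refl sum.swap)
    finally show ?thesis .
  qed
  let ?h = "\<lambda>v w n m n' m'. if n * m' * v = n' * m * w then c n * c m * r v * (c n' * c m' * r w) else 0"
  have "gcd_form (T^2) ?C V r = (\<Sum>v\<in>V. \<Sum>w\<in>V. \<Sum>n=1..T^2. ?C n *
      (\<Sum>m=1..T^2. ?C m * (if n * v = m * w then r v * r w else 0)))"
    unfolding gcd_form_def sum_distrib_left by (intro sum.cong refl) auto
  also have "\<dots> = (\<Sum>v\<in>V. \<Sum>w\<in>V. \<Sum>n=1..T. \<Sum>m'=1..T. \<Sum>n'=1..T. \<Sum>m=1..T. ?h v w n m n' m')"
    unfolding sum_dirichlet_square[OF c] unfolding sum_distrib_left by (intro sum.cong refl) auto
  also have "\<dots> = (\<Sum>v\<in>V. \<Sum>w\<in>V. \<Sum>n=1..T. \<Sum>m=1..T. \<Sum>n'=1..T. \<Sum>m'=1..T. ?h v w n m n' m')"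
    by (intro sum.cong refl rot)
  also have "\<dots> = (\<Sum>v\<in>V. \<Sum>n=1..T. \<Sum>w\<in>V. \<Sum>m=1..T. \<Sum>n'=1..T. \<Sum>m'=1..T. ?h v w n m n' m')"
    by (intro sum.cong refl sum.swap)
  also have "\<dots> = (\<Sum>v\<in>V. \<Sum>n=1..T. \<Sum>m=1..T. \<Sum>w\<in>V. \<Sum>n'=1..T. \<Sum>m'=1..T. ?h v w n m n' m')"
    by (intro sum.cong refl sum.swap)
  finally show ?thesis .
qed

text \<open>The form is the inner product over V of r with \<open>B\<close>, where \<open>B\<close>
  is convolution by c followed by its adjoint. Cauchy-Schwarz leaves the norm of \<open>B\<close>;
  expanded over pairs of triples, it is at most the squared norm of c * c * r.\<close>

lemma gcd_form_square_le:
  fixes c r :: "nat \<Rightarrow> real"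
  assumes c: "supported T c" and r: "\<And>v. 0 \<le> r v" and V: "finite V"
  shows "(gcd_form T c V r)\<^sup>2 \<le> (\<Sum>v\<in>V. (r v)\<^sup>2) * gcd_form (T^2) (dirichlet_square c) V r"
proof -
  have c0: "0 \<le> c n" for n using c by (simp add: supported_def)
  let ?I = "V \<times> {1..T} \<times> {1..T}"
  define f where "f = (\<lambda>(v, n, m). c n * c m * r v)"
  define P where "P = (\<lambda>(v, n, m) w. n * v = m * (w::nat))"
  define B where "B w = (\<Sum>i\<in>?I. if P i w then f i else 0)" for w
  have f0: "0 \<le> f i" for i using c0 r by (auto simp: f_def split: prod.split)
  have eq: "gcd_form T c V r = (\<Sum>w\<in>V. r w * B w)"
  proof -
    have "gcd_form T c V r = (\<Sum>w\<in>V. \<Sum>v\<in>V. \<Sum>n=1..T. \<Sum>m=1..T. if n * v = m * w then c n * c m * r v * r w else 0)"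
      unfolding gcd_form_def by (rule sum.swap)
    also have "\<dots> = (\<Sum>w\<in>V. r w * B w)"
      unfolding B_def sum.cartesian_product' sum_distrib_left
      by (intro sum.cong refl) (auto simp: f_def P_def)
    finally show ?thesis .
  qed
  have "(gcd_form T c V r)\<^sup>2 \<le> (\<Sum>v\<in>V. (r v)\<^sup>2) * (\<Sum>w\<in>V. (B w)\<^sup>2)"
    unfolding eq by (rule Cauchy_Schwarz_ineq_sum)
  also have "\<dots> \<le> (\<Sum>v\<in>V. (r v)\<^sup>2) * gcd_form (T^2) (dirichlet_square c) V r"
  proof (rule mult_left_mono)
    \<comment> \<open>\<open>R\<close> is the condition left when w is eliminated from
      \<open>P i w\<close> and \<open>P j w\<close>. Since m > 0, a triple determines its w, so each
      pair of triples is counted at most once.\<close>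
    define R where "R = (\<lambda>(v, n, m) (v', n', m'). n * m' * v = n' * m * (v'::nat))"
    have "(\<Sum>w\<in>V. (B w)\<^sup>2) = (\<Sum>w\<in>V. \<Sum>i\<in>?I. \<Sum>j\<in>?I. if P i w \<and> P j w then f i * f j else 0)"
      unfolding B_def power2_eq_square sum_product by (intro sum.cong refl) auto
    also have "\<dots> = (\<Sum>i\<in>?I. \<Sum>j\<in>?I. \<Sum>w\<in>V. if P i w \<and> P j w then f i * f j else 0)"
      by (subst sum.swap, intro sum.cong refl, rule sum.swap)
    also have "\<dots> \<le> (\<Sum>i\<in>?I. \<Sum>j\<in>?I. if R i j then f i * f j else 0)"
    proof (intro sum_mono)
      fix i j assume ij: "i \<in> ?I" "j \<in> ?I"
      obtain v n m v' n' m' where e: "i = (v, n, m)" "j = (v', n', m')" by (cases i, cases j) auto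
      have m0: "m > 0" "m' > 0" using ij e by auto
      have R: "R i j" if "P i w" "P j w" for w
      proof -
        have "n * m' * v = m * m' * w" using that e by (simp add: P_def)
        also have "\<dots> = n' * m * v'" using that e by (simp add: P_def)
        finally show ?thesis by (simp add: R_def e)
      qed
      have "(\<Sum>w\<in>V. if P i w \<and> P j w then f i * f j else 0) = (\<Sum>w\<in>{w\<in>V. P i w \<and> P j w}. f i * f j)"
        using V by (rule sum.inter_filter[symmetric])
      also have "\<dots> \<le> (if R i j then f i * f j else 0)"
      proof (cases "R i j")
        case True
        have "(\<Sum>w\<in>{w\<in>V. P i w \<and> P j w}. f i * f j) \<le> (\<Sum>w\<in>{n * v div m}. f i * f j)"
          using m0 f0 by (intro sum_mono2) (auto simp: P_def e)
        with True show ?thesis by simp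
      next
        case False
        then have "{w\<in>V. P i w \<and> P j w} = {}" using R by auto
        then show ?thesis using False by (simp only: sum.empty) auto
      qed
      finally show "(\<Sum>w\<in>V. if P i w \<and> P j w then f i * f j else 0) \<le> (if R i j then f i * f j else 0)" .
    qed
    also have "\<dots> = gcd_form (T^2) (dirichlet_square c) V r"
      unfolding gcd_form_dirichlet_square[OF c] sum.cartesian_product'
      by (intro sum.cong refl) (auto simp: f_def R_def)
    finally show "(\<Sum>w\<in>V. (B w)\<^sup>2) \<le> gcd_form (T^2) (dirichlet_square c) V r" .
  qed (auto intro: sum_nonneg)
  finally show ?thesis .
qed

text \<open>Iterates \<open>gcd_form_square_le\<close>, passing to the convolution square each time,
  and stops with \<open>gcd_form_le\<close>. The factor \<open>card V\<close> is lost only once, and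
  the square sum of c is logarithmic in the application, so both losses become negligible after
  taking the root of order \<open>2^j\<close>.\<close>

lemma gcd_form_power_le:
  fixes c r :: "nat \<Rightarrow> real"
  assumes "supported T c" "submult c" and r: "\<And>v. 0 \<le> r v" and V: "finite V" "\<And>v. v \<in> V \<Longrightarrow> v > 0"
  shows "gcd_form T c V r ^ (2^j) \<le> (\<Sum>v\<in>V. (r v)\<^sup>2) ^ (2^j) * (card V * (\<Sum>n=1..T. (c n)\<^sup>2) ^ (4^j))"
  using assms(1,2)
proof (induction j arbitrary: T c)
  case 0
  have "(\<Sum>v\<in>V. r v)\<^sup>2 \<le> (\<Sum>v\<in>V. 1\<^sup>2) * (\<Sum>v\<in>V. (r v)\<^sup>2)"
    using Cauchy_Schwarz_ineq_sum[of "\<lambda>_. 1" r V] by simp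
  then have "(\<Sum>v\<in>V. r v)\<^sup>2 * (\<Sum>n=1..T. (c n)\<^sup>2) \<le> (card V * (\<Sum>v\<in>V. (r v)\<^sup>2)) * (\<Sum>n=1..T. (c n)\<^sup>2)"
    by (intro mult_right_mono sum_nonneg) auto
  with gcd_form_le[OF 0(1) r V(2), of V "\<lambda>v. v"] show ?case by (simp add: mult_ac)
next
  case (Suc j)
  let ?R = "\<Sum>v\<in>V. (r v)\<^sup>2" and ?C = "dirichlet_square c"
  have R0: "?R \<ge> 0" by (intro sum_nonneg) auto
  have supC: "supported (T^2) ?C" by (rule supported_dirichlet_square[OF Suc.prems(1)])
  have "gcd_form T c V r ^ (2 ^ Suc j) = ((gcd_form T c V r)\<^sup>2) ^ (2^j)"
    by (simp add: power_mult[symmetric])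
  also have "\<dots> \<le> (?R * gcd_form (T^2) ?C V r) ^ (2^j)"
    by (intro power_mono gcd_form_square_le Suc.prems r V) auto
  also have "\<dots> = ?R ^ (2^j) * gcd_form (T^2) ?C V r ^ (2^j)"
    by (simp add: power_mult_distrib)
  also have "\<dots> \<le> ?R ^ (2^j) * (?R ^ (2^j) * (card V * (\<Sum>n=1..T^2. (?C n)\<^sup>2) ^ (4^j)))"
    using R0 Suc.IH[OF supC submult_dirichlet_square[OF Suc.prems]] by (intro mult_left_mono) auto
  also have "\<dots> \<le> ?R ^ (2^j) * (?R ^ (2^j) * (card V * ((\<Sum>n=1..T. (c n)\<^sup>2) ^ 4) ^ (4^j)))"
    using R0 by (intro mult_left_mono power_mono sum_power2_dirichlet_square Suc.prems sum_nonneg) auto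
  also have "\<dots> = ?R ^ (2 ^ Suc j) * (card V * (\<Sum>n=1..T. (c n)\<^sup>2) ^ (4 ^ Suc j))"
    by (simp add: power_mult[symmetric] power_add[symmetric] mult_2)
  finally show ?case .
qed

section \<open>The GCD sum and the weight 1 / sqrt n\<close>

definition inv_sqrt_upto :: "nat \<Rightarrow> nat \<Rightarrow> real" where
  "inv_sqrt_upto T n = (if n \<in> {1..T} then 1 / sqrt n else 0)"

lemma supported_inv_sqrt_upto: "supported T (inv_sqrt_upto T)"
  by (auto simp: supported_def inv_sqrt_upto_def)

text \<open>If x * y <= T then x and y are <= T as well, so whenever the left side survives the
  truncation, both factors on the right do too.\<close>

lemma submult_inv_sqrt_upto: "submult (inv_sqrt_upto T)"
  unfolding submult_def
proof (intro allI impI)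
  fix x y :: nat assume pos: "x > 0" "y > 0"
  show "inv_sqrt_upto T (x * y) \<le> inv_sqrt_upto T x * inv_sqrt_upto T y"
  proof (cases "x * y \<le> T")
    case True
    moreover have "x \<le> x * y" "y \<le> x * y" using pos by auto
    ultimately have "x \<le> T" "y \<le> T" by linarith+
    with True pos show ?thesis by (simp add: inv_sqrt_upto_def real_sqrt_mult)
  qed (simp add: inv_sqrt_upto_def)
qed

lemma sum_inv_sqrt_upto_square:
  assumes "T \<ge> 1"
  shows "(\<Sum>n=1..T. (inv_sqrt_upto T n)\<^sup>2) \<le> 1 + ln T"
proof -
  obtain t where t: "T = Suc t" using assms by (cases T) auto
  have "(\<Sum>n=1..T. (inv_sqrt_upto T n)\<^sup>2) = harm T"
    unfolding harm_def by (intro sum.cong) (auto simp: inv_sqrt_upto_def power_divide inverse_eq_divide)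
  moreover have "harm (Suc t) - ln (Suc t) \<le> (harm (Suc 0) - ln (Suc 0) :: real)"
    using decseqD[OF decseq_harm_diff_ln, of 0 t] by (simp only: le0 simp_thms)
  ultimately show ?thesis by (simp add: t harm_expand)
qed

text \<open>With v = g x and w = g y for g = gcd v w, the quotient is 1 / max x y <= 1 / sqrt (x y),
  which is the term (n, m) = (y, x) of the form. If x or y exceeds T, the quotient is at most 1 /
  T.\<close>

lemma gcd_sum_le_gcd_form:
  fixes r :: "nat \<Rightarrow> real"
  assumes r: "\<And>v. 0 \<le> r v" and V: "\<And>v. v \<in> V \<Longrightarrow> v > 0" and T: "T \<ge> 1"
  shows "(\<Sum>v\<in>V. \<Sum>w\<in>V. r v * r w * (real (gcd v w) / real (max v w)))
    \<le> gcd_form T (inv_sqrt_upto T) V r + (\<Sum>v\<in>V. r v)\<^sup>2 / T"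
proof -
  let ?c = "inv_sqrt_upto T"
  have c0: "0 \<le> ?c n" for n by (simp add: inv_sqrt_upto_def)
  have *: "real (gcd v w) / real (max v w) \<le> (\<Sum>n=1..T. \<Sum>m=1..T. if n * v = m * w then ?c n * ?c m else 0) + 1 / T"
    if vw: "v > 0" "w > 0" for v w :: nat
  proof -
    define g x y where "g = gcd v w" and "x = v div g" and "y = w div g"
    have g: "g > 0" "v = g * x" "w = g * y" using vw by (auto simp: g_def x_def y_def)
    then have xy: "x > 0" "y > 0" using vw by auto
    have e: "real (gcd v w) / real (max v w) = 1 / max x y"
    proof -
      have "max (real v) (real w) = g * max (real x) (real y)"
        using g by (auto simp: max_def)
      then have "real (max v w) = g * real (max x y)" by simp
      then show ?thesis using g(1) by (simp flip: g_def)
    qed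
    show ?thesis
    proof (cases "x \<le> T \<and> y \<le> T")
      case True
      have "1 / max (real x) (real y) \<le> ?c y * ?c x"
      proof -
        have "sqrt y * sqrt x \<le> sqrt (max x y) * sqrt (max x y)"
          by (intro mult_mono) auto
        then have "sqrt y * sqrt x \<le> max x y" by simp
        then show ?thesis using True xy by (simp add: inv_sqrt_upto_def frac_le)
      qed
      also have "\<dots> = (if y * v = x * w then ?c y * ?c x else 0)"
        using g by simp
      also have "\<dots> \<le> (\<Sum>m=1..T. if y * v = m * w then ?c y * ?c m else 0)"
        using True xy c0 by (intro member_le_sum[where f = "\<lambda>m. if y * v = m * w then ?c y * ?c m else 0"]) auto
      also have "\<dots> \<le> (\<Sum>n=1..T. \<Sum>m=1..T. if n * v = m * w then ?c n * ?c m else 0)"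
        using True xy c0
        by (intro member_le_sum[where f = "\<lambda>n. \<Sum>m=1..T. if n * v = m * w then ?c n * ?c m else 0"])
          (auto intro!: sum_nonneg)
      finally show ?thesis unfolding e by (simp add: add_increasing2)
    next
      case False
      then have "real T \<le> real (max x y)" unfolding of_nat_le_iff by auto
      then have "1 / real (max x y) \<le> 1 / T" using T by (intro divide_left_mono) auto
      moreover have "0 \<le> (\<Sum>n=1..T. \<Sum>m=1..T. if n * v = m * w then ?c n * ?c m else 0)"
        using c0 by (intro sum_nonneg) auto
      ultimately show ?thesis unfolding e by simp
    qed
  qed
  have "(\<Sum>v\<in>V. \<Sum>w\<in>V. r v * r w * (real (gcd v w) / real (max v w)))
      \<le> (\<Sum>v\<in>V. \<Sum>w\<in>V. r v * r w * ((\<Sum>n=1..T. \<Sum>m=1..T. if n * v = m * w then ?c n * ?c m else 0) + 1 / T))"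
    using V r by (intro sum_mono mult_left_mono *) auto
  also have "\<dots> = (\<Sum>v\<in>V. \<Sum>w\<in>V. r v * r w * (\<Sum>n=1..T. \<Sum>m=1..T. if n * v = m * w then ?c n * ?c m else 0))
      + (\<Sum>v\<in>V. \<Sum>w\<in>V. r v * r w) / T"
    by (simp add: distrib_left sum.distrib sum_divide_distrib)
  also have "(\<Sum>v\<in>V. \<Sum>w\<in>V. r v * r w * (\<Sum>n=1..T. \<Sum>m=1..T. if n * v = m * w then ?c n * ?c m else 0))
      = gcd_form T ?c V r"
    unfolding gcd_form_def sum_distrib_left by (intro sum.cong refl) auto
  also have "(\<Sum>v\<in>V. \<Sum>w\<in>V. r v * r w) = (\<Sum>v\<in>V. r v)\<^sup>2"
    by (simp add: power2_eq_square sum_product)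
  finally show ?thesis .
qed

text \<open>Uniformity in V and r is essential, because both will depend on N: they become the set
  of differences and its multiplicities.\<close>

lemma eventually_gcd_sum_le:
  fixes \<kappa> :: real
  assumes "\<kappa> > 0"
  shows "\<forall>\<^sub>F N::nat in sequentially. \<forall>V (r :: nat \<Rightarrow> real).
    finite V \<longrightarrow> (\<forall>v\<in>V. v > 0) \<longrightarrow> (\<forall>v. 0 \<le> r v) \<longrightarrow> card V \<le> N^2 \<longrightarrow> (\<Sum>v\<in>V. r v) \<le> real N ^ 2 \<longrightarrow>
    (\<Sum>v\<in>V. \<Sum>w\<in>V. r v * r w * (real (gcd v w) / real (max v w))) \<le> N powr \<kappa> * (\<Sum>v\<in>V. (r v)\<^sup>2) + real N ^ 2"
proof -
  \<comment> \<open>The root of order \<open>2^j\<close> is taken of \<open>card V\<close> <= N^2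
    times a logarithmic power <= N^3, hence of N^5, so \<open>2^j\<close> * \<kappa> >= 5
    suffices.\<close>
  obtain j :: nat where j: "5 / \<kappa> < 2 ^ j"
    using real_arch_pow[of 2 "5 / \<kappa>"] by auto
  define l :: nat where "l = 2 ^ j"
  define K :: nat where "K = 4 ^ j"
  have l: "l > 0" "5 \<le> \<kappa> * real l" using j assms by (auto simp: l_def field_simps)
  have "\<forall>\<^sub>F N::nat in sequentially. (1 + 2 * ln (real N)) ^ K \<le> real N ^ 3"
  proof -
    have "((\<lambda>x::real. x ^ K / exp x) \<longlongrightarrow> 0) at_top"
      by (rule tendsto_power_div_exp_0)
    then have "\<forall>\<^sub>F x::real in at_top. x ^ K / exp x < 1"
      by (rule order_tendstoD) simp
    moreover have "filterlim (\<lambda>N::nat. 1 + 2 * ln (real N)) at_top sequentially"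
      by real_asymp
    ultimately have "\<forall>\<^sub>F N::nat in sequentially. (1 + 2 * ln (real N)) ^ K / exp (1 + 2 * ln (real N)) < 1"
      unfolding filterlim_iff by blast
    moreover have "\<forall>\<^sub>F N::nat in sequentially. exp (1 + 2 * ln (real N)) \<le> real N ^ 3"
      by real_asymp
    ultimately show ?thesis by eventually_elim (simp add: field_simps)
  qed
  moreover have "\<forall>\<^sub>F N::nat in sequentially. N \<ge> 1" by (rule eventually_ge_at_top)
  ultimately show ?thesis
  proof eventually_elim
    case (elim N)
    show ?case
    proof (intro allI impI)
      fix V :: "nat set" and r :: "nat \<Rightarrow> real"
      assume V: "finite V" "\<forall>v\<in>V. v > 0" and r: "\<forall>v. 0 \<le> r v" and card: "card V \<le> N^2"
        and sum: "(\<Sum>v\<in>V. r v) \<le> real N ^ 2"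
      \<comment> \<open>With truncation at N^2 the error from large quotients is at most N^4 /
        N^2.\<close>
      let ?T = "N^2" let ?c = "inv_sqrt_upto ?T"
      let ?R = "\<Sum>v\<in>V. (r v)\<^sup>2" and ?S = "\<Sum>n=1..?T. (?c n)\<^sup>2"
      have T: "?T \<ge> 1" using elim by simp
      have R0: "?R \<ge> 0" by (intro sum_nonneg) auto
      have S: "?S \<le> 1 + 2 * ln N"
        using sum_inv_sqrt_upto_square[OF T] elim by (simp add: ln_realpow)
      have "gcd_form ?T ?c V r ^ l \<le> ?R ^ l * (card V * ?S ^ K)"
        unfolding l_def K_def
        using V r by (intro gcd_form_power_le supported_inv_sqrt_upto submult_inv_sqrt_upto) auto
      also have "\<dots> \<le> ?R ^ l * (real N ^ 2 * (1 + 2 * ln N) ^ K)"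
      proof (intro mult_left_mono mult_mono power_mono S)
        show "real (card V) \<le> real N ^ 2" using card by (simp flip: of_nat_power)
      qed (use R0 in \<open>auto intro!: sum_nonneg zero_le_power simp: inv_sqrt_upto_def\<close>)
      also have "\<dots> \<le> ?R ^ l * (real N ^ 2 * real N ^ 3)"
        using elim R0 by (intro mult_left_mono) auto
      also have "real N ^ 2 * real N ^ 3 = real N powr 5"
        using elim by (simp flip: power_add)
      also have "?R ^ l * real N powr 5 \<le> ?R ^ l * (real N powr (\<kappa> * l))"
        using elim R0 l by (intro mult_left_mono powr_mono) auto
      also have "\<dots> = (?R * N powr \<kappa>) ^ l"
        using elim by (simp add: power_mult_distrib powr_powr[symmetric] powr_realpow)
      finally have "gcd_form ?T ?c V r \<le> ?R * N powr \<kappa>"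
        using l R0 by (subst (asm) power_mono_iff)
          (auto intro!: gcd_form_nonneg supported_inv_sqrt_upto mult_nonneg_nonneg simp: r)
      moreover have "(\<Sum>v\<in>V. r v)\<^sup>2 / ?T \<le> real N ^ 2"
      proof -
        have "(\<Sum>v\<in>V. r v)\<^sup>2 \<le> (real N ^ 2)\<^sup>2"
          using sum r by (intro power_mono sum_nonneg) auto
        then show ?thesis using elim by (simp add: field_simps power2_eq_square)
      qed
      moreover have "(\<Sum>v\<in>V. \<Sum>w\<in>V. r v * r w * (real (gcd v w) / real (max v w)))
          \<le> gcd_form ?T ?c V r + (\<Sum>v\<in>V. r v)\<^sup>2 / ?T"
        using V r T by (intro gcd_sum_le_gcd_form) auto
      ultimately show "(\<Sum>v\<in>V. \<Sum>w\<in>V. r v * r w * (real (gcd v w) / real (max v w)))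
          \<le> N powr \<kappa> * ?R + real N ^ 2"
        by (simp add: mult.commute)
    qed
  qed
qed

section \<open>Pair correlations of dilated copies of an interval modulo 1\<close>

lemma dist_nearest_int_le_iff: "dist_nearest_int t \<le> \<delta> \<longleftrightarrow> (\<exists>n::int. \<bar>t - of_int n\<bar> \<le> \<delta>)"
proof
  assume le: "dist_nearest_int t \<le> \<delta>"
  obtain x where "x \<in> (\<int>::real set)" "infdist t \<int> = dist t x"
    by (rule infdist_attains_inf[of "\<int>::real set" t]) auto
  with le show "\<exists>n::int. \<bar>t - of_int n\<bar> \<le> \<delta>"
    by (auto simp: dist_nearest_int_def dist_real_def elim!: Ints_cases)
next
  assume "\<exists>n::int. \<bar>t - of_int n\<bar> \<le> \<delta>"
  then obtain n :: int where "\<bar>t - of_int n\<bar> \<le> \<delta>" by blast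
  moreover have "infdist t \<int> \<le> dist t (of_int n)" by (rule infdist_le) auto
  ultimately show "dist_nearest_int t \<le> \<delta>" by (simp add: dist_nearest_int_def dist_real_def)
qed

lemma dist_nearest_int_eqI:
  assumes "\<And>\<delta>. dist_nearest_int x \<le> \<delta> \<longleftrightarrow> dist_nearest_int y \<le> \<delta>"
  shows "dist_nearest_int x = dist_nearest_int y"
  using assms[of "dist_nearest_int x"] assms[of "dist_nearest_int y"] by simp

lemma dist_nearest_int_add_of_int [simp]: "dist_nearest_int (t + of_int n) = dist_nearest_int t"
proof (rule dist_nearest_int_eqI)
  fix \<delta>
  have "(\<exists>m::int. \<bar>t + of_int n - of_int m\<bar> \<le> \<delta>) \<longleftrightarrow> (\<exists>m::int. \<bar>t - of_int m\<bar> \<le> \<delta>)"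
  proof safe
    fix m :: int assume "\<bar>t + of_int n - of_int m\<bar> \<le> \<delta>"
    then show "\<exists>m::int. \<bar>t - of_int m\<bar> \<le> \<delta>" by (intro exI[of _ "m - n"]) (simp add: algebra_simps)
  next
    fix m :: int assume "\<bar>t - of_int m\<bar> \<le> \<delta>"
    then show "\<exists>m::int. \<bar>t + of_int n - of_int m\<bar> \<le> \<delta>"
      by (intro exI[of _ "m + n"]) (simp add: algebra_simps)
  qed
  then show "dist_nearest_int (t + of_int n) \<le> \<delta> \<longleftrightarrow> dist_nearest_int t \<le> \<delta>"
    by (simp add: dist_nearest_int_le_iff)
qed

lemma dist_nearest_int_minus [simp]: "dist_nearest_int (- t) = dist_nearest_int t"
proof (rule dist_nearest_int_eqI)
  fix \<delta>
  have *: "\<exists>m::int. \<bar>- u - of_int m\<bar> \<le> \<delta>" if "\<bar>u - of_int m\<bar> \<le> \<delta>" for m :: int and u :: real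
    using that by (intro exI[of _ "-m"]) (simp add: abs_minus_commute[of u])
  show "dist_nearest_int (- t) \<le> \<delta> \<longleftrightarrow> dist_nearest_int t \<le> \<delta>"
    unfolding dist_nearest_int_le_iff using *[of t] *[of "-t"] by auto
qed

lemma dist_nearest_int_lipschitz: "dist_nearest_int x \<le> dist_nearest_int y + \<bar>x - y\<bar>"
  using infdist_triangle_abs[of x \<int> y] by (simp add: dist_nearest_int_def dist_real_def)

lemma dist_nearest_int_frac_diff [simp]:
  "dist_nearest_int (frac x - frac y) = dist_nearest_int (x - y)"
proof -
  have "x - y = frac x - frac y + of_int (\<lfloor>x\<rfloor> - \<lfloor>y\<rfloor>)" by (simp add: frac_def)
  then show ?thesis by (metis dist_nearest_int_add_of_int)
qed

lemma borel_measurable_dist_nearest_int [measurable]: "dist_nearest_int \<in> borel_measurable borel"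
  unfolding dist_nearest_int_def by (intro borel_measurable_continuous_onI continuous_intros)

text \<open>The preimage of the arc of radius \<delta> around 0 in R/Z under multiplication by v;
  for v > 0 it is invariant under translation by 1 / v.\<close>

definition dilated_arc :: "real \<Rightarrow> nat \<Rightarrow> real set" where
  "dilated_arc \<delta> v = {x. dist_nearest_int (v * x) \<le> \<delta>}"

lemma sets_dilated_arc [measurable]: "dilated_arc \<delta> v \<in> sets borel"
  unfolding dilated_arc_def by measurable

text \<open>Because V and W are coprime, the points i V / W are the multiples of 1 / W modulo 1 in
  another order, so an arc of length 2 \<delta> catches at most 2 \<delta> W + 1 of them.\<close>

lemma card_arc_hits_le:
  fixes y \<delta> :: real and V W :: nat
  assumes "coprime V W" "W > 0" "\<delta> \<ge> 0"
  shows "card {i. i < W \<and> dist_nearest_int (y + real i * real V / real W) \<le> \<delta>} \<le> 2 * \<delta> * W + 1"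
proof -
  let ?I = "{i. i < W \<and> dist_nearest_int (y + real i * real V / real W) \<le> \<delta>}"
  have "\<forall>i. \<exists>n::int. i \<in> ?I \<longrightarrow> \<bar>y + real i * real V / real W - of_int n\<bar> \<le> \<delta>"
    by (auto simp: dist_nearest_int_le_iff)
  from choice[OF this] obtain n :: "nat \<Rightarrow> int"
    where n: "\<And>i. i \<in> ?I \<Longrightarrow> \<bar>y + real i * real V / real W - of_int (n i)\<bar> \<le> \<delta>"
    by blast
  \<comment> \<open>A representative of the i-th point, scaled by W and without the shift y: an
    integer congruent to i V modulo W, which determines i, and within \<delta> W of - y W.\<close>
  define z where "z i = int i * int V - n i * int W" for i
  have "inj_on z ?I"
  proof (rule inj_onI)
    fix i j assume ij: "i \<in> ?I" "j \<in> ?I" "z i = z j"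
    then have "(int i - int j) * int V = (n i - n j) * int W"
      by (simp add: z_def algebra_simps)
    then have "int W dvd (int i - int j) * int V" by (metis dvd_triv_right)
    then have "int W dvd int i - int j"
      using assms(1) by (simp add: coprime_commute coprime_dvd_mult_left_iff)
    then show "i = j"
      using ij zdvd_imp_le[of "int W" "int i - int j"] zdvd_imp_le[of "int W" "int j - int i"]
      by (cases i j rule: linorder_cases) (auto simp: dvd_diff_commute)
  qed
  moreover have "z ` ?I \<subseteq> {\<lceil>- y * W - \<delta> * W\<rceil>..\<lfloor>- y * W + \<delta> * W\<rfloor>}"
  proof (rule image_subsetI)
    fix i assume i: "i \<in> ?I"
    have "y * W + z i = (y + real i * real V / real W - of_int (n i)) * W"
      using assms(2) by (simp add: z_def field_simps)
    then have "\<bar>y * W + z i\<bar> = \<bar>(y + real i * real V / real W - of_int (n i)) * W\<bar>" by simp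
    also have "\<dots> \<le> \<delta> * W"
      using n[OF i] assms(2) by (simp add: abs_mult)
    finally show "z i \<in> {\<lceil>- y * W - \<delta> * W\<rceil>..\<lfloor>- y * W + \<delta> * W\<rfloor>}"
      by (auto simp: ceiling_le_iff le_floor_iff)
  qed
  ultimately have "card ?I \<le> card {\<lceil>- y * W - \<delta> * W\<rceil>..\<lfloor>- y * W + \<delta> * W\<rfloor>}"
    by (intro card_inj_on_le) auto
  then have "real (card ?I) \<le> real (nat (\<lfloor>- y * W + \<delta> * W\<rfloor> - \<lceil>- y * W - \<delta> * W\<rceil> + 1))"
    by simp
  also have "\<dots> \<le> 2 * \<delta> * W + 1"
  proof -
    have "0 \<le> 2 * \<delta> * W + 1" using assms by (simp add: add_nonneg_nonneg)
    moreover have "real_of_int (\<lfloor>- y * W + \<delta> * W\<rfloor> - \<lceil>- y * W - \<delta> * W\<rceil> + 1) \<le> 2 * \<delta> * W + 1"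
      using of_int_floor_le[of "- y * W + \<delta> * W"] le_of_int_ceiling[of "- y * W - \<delta> * W"]
      unfolding of_int_add of_int_diff of_int_1 by argo
    ultimately show ?thesis by (cases "0 \<le> \<lfloor>- y * W + \<delta> * W\<rfloor> - \<lceil>- y * W - \<delta> * W\<rceil> + 1") auto
  qed
  finally show ?thesis .
qed

lemma nn_integral_periodic_translate:
  fixes g :: "real \<Rightarrow> ennreal"
  assumes [measurable]: "g \<in> borel_measurable borel" and per: "\<And>x. g (x + 1) = g x" and c: "0 \<le> c" "c \<le> 1"
  shows "(\<integral>\<^sup>+x. g (x + c) * indicator {0..<1} x \<partial>lborel) = (\<integral>\<^sup>+x. g x * indicator {0..<1} x \<partial>lborel)"
proof -
  have "(\<integral>\<^sup>+x. g (x + c) * indicator {0..<1} x \<partial>lborel) = (\<integral>\<^sup>+x. g x * indicator {c..<1 + c} x \<partial>lborel)"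
    by (subst (2) nn_integral_real_affine[where c = 1 and t = c])
      (auto simp: add.commute intro!: nn_integral_cong split: split_indicator)
  \<comment> \<open>The overhang [1, 1 + c) is split off, to be moved back to [0, c) by
    periodicity.\<close>
  also have "\<dots> = (\<integral>\<^sup>+x. g x * indicator {c..<1} x + g x * indicator {1..<1 + c} x \<partial>lborel)"
    using c by (intro nn_integral_cong) (auto split: split_indicator)
  also have "\<dots> = (\<integral>\<^sup>+x. g x * indicator {c..<1} x \<partial>lborel) + (\<integral>\<^sup>+x. g x * indicator {1..<1 + c} x \<partial>lborel)"
    by (intro nn_integral_add) auto
  also have "(\<integral>\<^sup>+x. g x * indicator {1..<1 + c} x \<partial>lborel) = (\<integral>\<^sup>+x. g x * indicator {0..<c} x \<partial>lborel)"
    by (subst nn_integral_real_affine[where c = 1 and t = 1])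
      (auto simp: add.commute per intro!: nn_integral_cong split: split_indicator)
  also have "(\<integral>\<^sup>+x. g x * indicator {c..<1} x \<partial>lborel) + (\<integral>\<^sup>+x. g x * indicator {0..<c} x \<partial>lborel)
      = (\<integral>\<^sup>+x. g x * indicator {c..<1} x + g x * indicator {0..<c} x \<partial>lborel)"
    by (intro nn_integral_add[symmetric]) auto
  also have "\<dots> = (\<integral>\<^sup>+x. g x * indicator {0..<1} x \<partial>lborel)"
    using c by (intro nn_integral_cong) (auto split: split_indicator)
  finally show ?thesis .
qed

lemma nn_integral_periodic_dilate:
  fixes g :: "real \<Rightarrow> ennreal"
  assumes [measurable]: "g \<in> borel_measurable borel" and per: "\<And>x (n::nat). g (x + n) = g x" and v: "v > 0"
  shows "(\<integral>\<^sup>+x. g (real v * x) * indicator {0..<1} x \<partial>lborel) = (\<integral>\<^sup>+x. g x * indicator {0..<1} x \<partial>lborel)"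
proof -
  let ?J = "\<integral>\<^sup>+x. g x * indicator {0..<1} x \<partial>lborel"
  have 1: "(\<integral>\<^sup>+x. g x * indicator {real n..<real n + 1} x \<partial>lborel) = ?J" for n :: nat
    by (subst nn_integral_real_affine[where c = 1 and t = n])
      (auto simp: add.commute per intro!: nn_integral_cong split: split_indicator)
  have 2: "(\<integral>\<^sup>+x. g x * indicator {0..<real n} x \<partial>lborel) = of_nat n * ?J" for n :: nat
  proof (induction n)
    case (Suc n)
    have "(\<integral>\<^sup>+x. g x * indicator {0..<real (Suc n)} x \<partial>lborel)
       = (\<integral>\<^sup>+x. g x * indicator {0..<real n} x + g x * indicator {real n..<real n + 1} x \<partial>lborel)"
      by (intro nn_integral_cong) (auto split: split_indicator)
    also have "\<dots> = of_nat n * ?J + ?J"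
      by (subst nn_integral_add) (auto simp: Suc 1)
    finally show ?case by (simp add: distrib_right add.commute)
  qed auto
  have "of_nat v * ?J = (\<integral>\<^sup>+x. g x * indicator {0..<real v} x \<partial>lborel)" by (simp add: 2)
  also have "\<dots> = ennreal v * (\<integral>\<^sup>+x. g (real v * x) * indicator {0..<1} x \<partial>lborel)"
    using v by (subst nn_integral_real_affine[where c = "real v" and t = 0])
      (auto simp: zero_le_mult_iff intro!: arg_cong2[where f = "(*)"] nn_integral_cong split: split_indicator)
  finally show ?thesis
    using v by (simp add: ennreal_of_nat_eq_real_of_nat ennreal_mult_cancel_left)
qed

lemma indicator_dilated_arc_periodic:
  assumes "v * c = of_int n"
  shows "indicator (dilated_arc \<delta> v) (x + c) = indicator (dilated_arc \<delta> v) x"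
  using assms by (simp add: indicator_def dilated_arc_def distrib_left)

lemma nn_integral_dilated_arc:
  assumes \<delta>: "0 \<le> \<delta>" "\<delta> < 1/2" and v: "v > 0"
  shows "(\<integral>\<^sup>+x. indicator (dilated_arc \<delta> v) x * indicator {0..<1} x \<partial>lborel) = ennreal (2 * \<delta>)"
proof -
  let ?g = "indicator (dilated_arc \<delta> 1) :: real \<Rightarrow> ennreal"
  have "(\<integral>\<^sup>+x. indicator (dilated_arc \<delta> v) x * indicator {0..<1} x \<partial>lborel)
      = (\<integral>\<^sup>+x. ?g (real v * x) * indicator {0..<1} x \<partial>lborel)"
    by (simp add: dilated_arc_def indicator_def)
  also have "\<dots> = (\<integral>\<^sup>+x. ?g x * indicator {0..<1} x \<partial>lborel)"
  proof (rule nn_integral_periodic_dilate[OF _ _ v])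
    show "?g (x + real n) = ?g x" for x and n :: nat
      by (rule indicator_dilated_arc_periodic[of _ _ "int n"]) simp
  qed simp
  \<comment> \<open>Since \<delta> < 1/2, the arc around 0 appears in the unit interval as two
    disjoint end pieces of length \<delta> each.\<close>
  also have "\<dots> = (\<integral>\<^sup>+x. indicator {0..\<delta>} x + indicator {1 - \<delta>..<1} x \<partial>lborel)"
  proof (rule nn_integral_cong)
    fix x :: real
    have "dist_nearest_int x \<le> \<delta> \<longleftrightarrow> x \<le> \<delta> \<or> 1 - \<delta> \<le> x" if x: "0 \<le> x" "x < 1"
    proof
      assume "dist_nearest_int x \<le> \<delta>"
      then obtain n :: int where n: "\<bar>x - of_int n\<bar> \<le> \<delta>" by (auto simp: dist_nearest_int_le_iff)
      then have "of_int n < (2::real)" "of_int n > (-1::real)" using x \<delta> by linarith+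
      then have "n = 0 \<or> n = 1" by linarith
      with n show "x \<le> \<delta> \<or> 1 - \<delta> \<le> x" by auto
    next
      assume "x \<le> \<delta> \<or> 1 - \<delta> \<le> x"
      then show "dist_nearest_int x \<le> \<delta>"
        unfolding dist_nearest_int_le_iff using x
        by (auto intro: exI[of _ "0::int"] exI[of _ "1::int"])
    qed
    then show "?g x * indicator {0..<1} x = (indicator {0..\<delta>} x + indicator {1 - \<delta>..<1} x :: ennreal)"
      using \<delta> by (auto simp: dilated_arc_def split: split_indicator)
  qed
  also have "\<dots> = ennreal \<delta> + ennreal \<delta>"
    using \<delta> by (subst nn_integral_add) auto
  finally show ?thesis using \<delta> by (simp flip: ennreal_plus)
qed

text \<open>
  Translation by a multiple of \<open>1 / w\<close> preserves the second arc, so its intersection with the first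
  one can be averaged over \<open>w / gcd v w\<close> translates, whose positions are equidistributed modulo 1.
\<close>

lemma nn_integral_dilated_arc_inter:
  assumes \<delta>: "0 \<le> \<delta>" "\<delta> < 1/2" and vw: "v > 0" "w > 0"
  shows "(\<integral>\<^sup>+x. indicator (dilated_arc \<delta> v \<inter> dilated_arc \<delta> w) x * indicator {0..<1} x \<partial>lborel)
    \<le> ennreal (4 * \<delta>\<^sup>2 + 2 * \<delta> * (real (gcd v w) / real w))"
proof -
  define g V W where "g = gcd v w" and "V = v div g" and "W = w div g"
  have g: "g > 0" "v = g * V" "w = g * W" using vw by (auto simp: g_def V_def W_def)
  have cop: "coprime V W" using vw by (auto simp: V_def W_def g_def div_gcd_coprime)
  have W: "W > 0" using g vw by auto
  define h where "h = (indicator (dilated_arc \<delta> v \<inter> dilated_arc \<delta> w) :: real \<Rightarrow> ennreal)"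
  let ?J = "\<integral>\<^sup>+x. h x * indicator {0..<1} x \<partial>lborel"
  have [measurable]: "h \<in> borel_measurable borel" by (simp add: h_def)
  have per: "h (x + 1) = h x" for x
    unfolding h_def indicator_inter_arith
    by (intro arg_cong2[where f = "(*)"] indicator_dilated_arc_periodic[of _ _ "int v"]
        indicator_dilated_arc_periodic[of _ _ "int w"]) auto
  have w_shift: "real w * (x + real i / real w) = real w * x + of_int (int i)" for x i
    using vw by (simp add: field_simps)
  have v_shift: "real v * (x + real i / real w) = real v * x + real i * real V / real W" for x i
    using g vw by (simp add: field_simps)
  have "of_nat W * ?J = (\<Sum>i<W. ?J)" by simp
  also have "\<dots> = (\<Sum>i<W. \<integral>\<^sup>+x. h (x + real i / real w) * indicator {0..<1} x \<partial>lborel)"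
  proof (rule sum.cong[OF refl])
    fix i assume "i \<in> {..<W}"
    then have "i \<le> w" using g by (metis lessThan_iff less_le_trans less_imp_le mult_le_mono1 nat_mult_1 Suc_leI One_nat_def)
    then show "?J = (\<integral>\<^sup>+x. h (x + real i / real w) * indicator {0..<1} x \<partial>lborel)"
      using vw by (intro nn_integral_periodic_translate[symmetric] per) auto
  qed
  also have "\<dots> = (\<integral>\<^sup>+x. (\<Sum>i<W. h (x + real i / real w) * indicator {0..<1} x) \<partial>lborel)"
    by (intro nn_integral_sum[symmetric]) auto
  \<comment> \<open>For x in the second arc, the number of translates of x that fall into the first
    arc is bounded by \<open>card_arc_hits_le\<close>.\<close>
  also have "\<dots> \<le> (\<integral>\<^sup>+x. ennreal (2 * \<delta> * W + 1) * (indicator (dilated_arc \<delta> w) x * indicator {0..<1} x) \<partial>lborel)"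
  proof (rule nn_integral_mono)
    fix x :: real
    let ?I = "{i. i < W \<and> dist_nearest_int (v * x + real i * real V / real W) \<le> \<delta>}"
    have "(\<Sum>i<W. h (x + real i / real w) * indicator {0..<1} x)
        = (\<Sum>i<W. indicator (dilated_arc \<delta> w) x * indicator {0..<1} x * indicator ?I i)"
      by (intro sum.cong refl)
        (auto simp: h_def dilated_arc_def indicator_def v_shift w_shift simp del: of_int_of_nat_eq)
    also have "\<dots> = (indicator (dilated_arc \<delta> w) x * indicator {0..<1} x) * (\<Sum>i<W. indicator ?I i)"
      by (simp add: sum_distrib_left)
    also have "(\<Sum>i<W. indicator ?I i) = (of_nat (card ?I) :: ennreal)"
    proof -
      have "(\<Sum>i<W. indicator ?I i) = (\<Sum>i\<in>?I. (1::ennreal))"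
        by (rule sum.mono_neutral_cong_right) auto
      then show ?thesis by simp
    qed
    also have "(indicator (dilated_arc \<delta> w) x * indicator {0..<1} x) * (of_nat (card ?I) :: ennreal)
        \<le> (indicator (dilated_arc \<delta> w) x * indicator {0..<1} x) * ennreal (2 * \<delta> * W + 1)"
      using card_arc_hits_le[OF cop W \<delta>(1), of "v * x"]
      by (intro mult_left_mono) (simp_all add: ennreal_of_nat_eq_real_of_nat ennreal_leI)
    finally show "(\<Sum>i<W. h (x + real i / real w) * indicator {0..<1} x)
        \<le> ennreal (2 * \<delta> * W + 1) * (indicator (dilated_arc \<delta> w) x * indicator {0..<1} x)"
      by (subst mult.commute)
  qed
  also have "\<dots> = ennreal (2 * \<delta> * W + 1) * ennreal (2 * \<delta>)"
    by (subst nn_integral_cmult) (auto simp: nn_integral_dilated_arc[OF \<delta> vw(2)])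
  also have "\<dots> = of_nat W * ennreal (4 * \<delta>\<^sup>2 + 2 * \<delta> * (real (gcd v w) / real w))"
  proof -
    \<comment> \<open>After division by W, with 1 / W = gcd v w / w, this is the product of the two
      measures plus the covariance bound.\<close>
    have "(2 * \<delta> * W + 1) * (2 * \<delta>) = W * (4 * \<delta>\<^sup>2 + 2 * \<delta> * (real (gcd v w) / real w))"
    proof -
      have "real (gcd v w) / real w = 1 / W"
        unfolding g_def[symmetric] using g(1) W by (simp add: g(3))
      then show ?thesis using W by (simp add: field_simps power2_eq_square)
    qed
    moreover have "0 \<le> 2 * \<delta> * W + 1" "0 \<le> 4 * \<delta>\<^sup>2 + 2 * \<delta> * (real (gcd v w) / real w)"
      using \<delta> by (auto intro!: add_nonneg_nonneg)
    ultimately show ?thesis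
      using \<delta> unfolding ennreal_of_nat_eq_real_of_nat
      by (simp only: ennreal_mult[symmetric] of_nat_0_le_iff zero_le_mult_iff zero_le_numeral simp_thms)
  qed
  finally show ?thesis
    using W unfolding h_def by (simp add: ennreal_mult_le_mult_iff ennreal_of_nat_eq_real_of_nat)
qed

section \<open>Variance of the number of close pairs on the unit interval\<close>

definition unit_measure :: "real measure" where
  "unit_measure = restrict_space lborel {0..<1}"

lemma space_unit_measure [simp]: "space unit_measure = {0..<1}"
  by (simp add: unit_measure_def space_restrict_space)

lemma sets_unit_measure: "sets unit_measure = sets (restrict_space borel {0..<1})"
  unfolding unit_measure_def by (intro sets_restrict_space_cong) simp

lemma measurable_unit_measure: "f \<in> borel_measurable borel \<Longrightarrow> f \<in> borel_measurable unit_measure"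
  unfolding unit_measure_def by (rule measurable_restrict_space1) simp

lemma prob_space_unit_measure: "prob_space unit_measure"
  unfolding unit_measure_def by (rule prob_space_restrict_space) auto

lemma emeasure_unit_measure:
  "A \<in> sets borel \<Longrightarrow> emeasure unit_measure (A \<inter> {0..<1}) = (\<integral>\<^sup>+x. indicator A x * indicator {0..<1} x \<partial>lborel)"
  unfolding unit_measure_def
  by (subst emeasure_restrict_space) (auto simp flip: indicator_inter_arith)

lemma integral_unit_measure_indicator:
  assumes "A \<in> sets borel"
  shows "integral\<^sup>L unit_measure (indicator A) = measure unit_measure (A \<inter> {0..<1})"
    "integrable unit_measure (indicator A :: real \<Rightarrow> real)"
proof -
  interpret prob_space unit_measure by (rule prob_space_unit_measure)
  show "integral\<^sup>L unit_measure (indicator A) = measure unit_measure (A \<inter> {0..<1})"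
    using assms by simp
  show "integrable unit_measure (indicator A :: real \<Rightarrow> real)"
    using assms by (intro integrable_const_bound[where B = 1])
      (auto intro!: measurable_unit_measure split: split_indicator)
qed

lemma measure_dilated_arc:
  assumes "0 \<le> \<delta>" "\<delta> < 1/2" "v > 0"
  shows "measure unit_measure (dilated_arc \<delta> v \<inter> {0..<1}) = 2 * \<delta>"
  using assms by (simp add: measure_def emeasure_unit_measure nn_integral_dilated_arc)

text \<open>The averaging can use translates that preserve either arc; the larger multiplier gives
  the better bound.\<close>

lemma measure_dilated_arc_inter:
  assumes \<delta>: "0 \<le> \<delta>" "\<delta> < 1/2" and vw: "v > 0" "w > 0"
  shows "measure unit_measure ((dilated_arc \<delta> v \<inter> dilated_arc \<delta> w) \<inter> {0..<1})
    \<le> 4 * \<delta>\<^sup>2 + 2 * \<delta> * (real (gcd v w) / real (max v w))"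
proof -
  have *: "measure unit_measure ((dilated_arc \<delta> v \<inter> dilated_arc \<delta> w) \<inter> {0..<1})
    \<le> 4 * \<delta>\<^sup>2 + 2 * \<delta> * (real (gcd v w) / real w)" if "v > 0" "w > 0" for v w
  proof -
    have "emeasure unit_measure ((dilated_arc \<delta> v \<inter> dilated_arc \<delta> w) \<inter> {0..<1})
        \<le> ennreal (4 * \<delta>\<^sup>2 + 2 * \<delta> * (real (gcd v w) / real w))"
      using nn_integral_dilated_arc_inter[OF \<delta> that] by (subst emeasure_unit_measure) auto
    then show ?thesis using \<delta> by (simp add: measure_def enn2real_leI)
  qed
  show ?thesis
    using *[OF vw] *[OF vw(2) vw(1)] by (cases "v \<le> w") (auto simp: max_def gcd.commute Int_commute)
qed

text \<open>Chebyshev's inequality. The main terms 4 \<delta>^2 of the second moment add up to the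
  square of the mean, so the GCD sum alone bounds the variance. The family u may repeat values,
  which is how multiplicities of differences enter.\<close>

lemma prob_deviation_le:
  fixes u :: "'a \<Rightarrow> nat"
  assumes P: "finite P" and u: "\<And>p. p \<in> P \<Longrightarrow> u p > 0" and \<delta>: "0 \<le> \<delta>" "\<delta> < 1/2" and c: "c > 0"
  shows "measure unit_measure {x \<in> {0..<1}. c \<le> \<bar>(\<Sum>p\<in>P. indicator (dilated_arc \<delta> (u p)) x) - 2 * \<delta> * card P\<bar>}
    \<le> 2 * \<delta> * (\<Sum>p\<in>P. \<Sum>q\<in>P. real (gcd (u p) (u q)) / real (max (u p) (u q))) / c\<^sup>2"
proof -
  interpret prob_space unit_measure by (rule prob_space_unit_measure)
  let ?S = "\<lambda>p. dilated_arc \<delta> (u p)"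
  define X :: "real \<Rightarrow> real" where "X x = (\<Sum>p\<in>P. indicator (?S p) x)" for x
  have Xm [measurable]: "X \<in> borel_measurable borel" unfolding X_def by measurable
  have intX: "integrable unit_measure X"
    unfolding X_def by (intro Bochner_Integration.integrable_sum integral_unit_measure_indicator) auto
  have X2: "(X x)\<^sup>2 = (\<Sum>p\<in>P. \<Sum>q\<in>P. indicator (?S p \<inter> ?S q) x)" for x
    unfolding X_def power2_eq_square sum_product by (simp add: indicator_inter_arith)
  have intX2: "integrable unit_measure (\<lambda>x. (X x)\<^sup>2)"
    unfolding X2 by (intro Bochner_Integration.integrable_sum integral_unit_measure_indicator) auto
  have EX: "expectation X = 2 * \<delta> * card P"
  proof -
    have "expectation X = (\<Sum>p\<in>P. measure unit_measure (?S p \<inter> {0..<1}))"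
      unfolding X_def
      by (simp add: integral_unit_measure_indicator)
    also have "\<dots> = (\<Sum>p\<in>P. 2 * \<delta>)"
      using u \<delta> by (intro sum.cong refl measure_dilated_arc) auto
    finally show ?thesis by simp
  qed
  have EX2: "expectation (\<lambda>x. (X x)\<^sup>2) \<le>
      (2 * \<delta> * card P)\<^sup>2 + 2 * \<delta> * (\<Sum>p\<in>P. \<Sum>q\<in>P. real (gcd (u p) (u q)) / real (max (u p) (u q)))"
  proof -
    have "expectation (\<lambda>x. (X x)\<^sup>2) = (\<Sum>p\<in>P. \<Sum>q\<in>P. measure unit_measure ((?S p \<inter> ?S q) \<inter> {0..<1}))"
      unfolding X2
      by (simp add: integral_unit_measure_indicator)
    also have "\<dots> \<le> (\<Sum>p\<in>P. \<Sum>q\<in>P. 4 * \<delta>\<^sup>2 + 2 * \<delta> * (real (gcd (u p) (u q)) / real (max (u p) (u q))))"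
      using u \<delta> by (intro sum_mono measure_dilated_arc_inter) auto
    also have "\<dots> = (2 * \<delta> * card P)\<^sup>2 + 2 * \<delta> * (\<Sum>p\<in>P. \<Sum>q\<in>P. real (gcd (u p) (u q)) / real (max (u p) (u q)))"
      by (simp add: sum.distrib sum_distrib_left power2_eq_square)
    finally show ?thesis .
  qed
  have "prob {x \<in> space unit_measure. c \<le> \<bar>X x - expectation X\<bar>} \<le> variance X / c\<^sup>2"
    by (rule Chebyshev_inequality[OF measurable_unit_measure[OF Xm] intX2 c])
  also have "variance X = expectation (\<lambda>x. (X x)\<^sup>2) - (expectation X)\<^sup>2"
    by (rule variance_eq[OF intX intX2])
  also have "\<dots> \<le> 2 * \<delta> * (\<Sum>p\<in>P. \<Sum>q\<in>P. real (gcd (u p) (u q)) / real (max (u p) (u q)))"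
    using EX2 unfolding EX by simp
  finally show ?thesis
    using c unfolding EX by (simp add: X_def divide_right_mono)
qed

section \<open>Deviation of the pair correlation function\<close>

definition index_pairs :: "nat \<Rightarrow> (nat \<times> nat) set" where
  "index_pairs N = {(j, k). j \<in> {1..N} \<and> k \<in> {1..N} \<and> j \<noteq> k}"

text \<open>The absolute value is harmless, as the distance to the nearest integer is even, but it
  merges a difference with its negative; this causes the factor 2 in
  \<open>sum_gap_multiplicity_square_le\<close>.\<close>

definition gap :: "(nat \<Rightarrow> int) \<Rightarrow> nat \<times> nat \<Rightarrow> nat" where
  "gap a p = nat \<bar>a (fst p) - a (snd p)\<bar>"

lemma finite_index_pairs [simp]: "finite (index_pairs N)"
  by (rule finite_subset[of _ "{1..N} \<times> {1..N}"]) (auto simp: index_pairs_def)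

lemma card_index_pairs: "card (index_pairs N) = N\<^sup>2 - N"
proof -
  have "index_pairs N = {1..N} \<times> {1..N} - (\<lambda>j. (j, j)) ` {1..N}"
    by (auto simp: index_pairs_def)
  then have "card (index_pairs N) = card ({1..N} \<times> {1..N}) - card ((\<lambda>j. (j, j)) ` {1..N})"
    by (simp only:) (rule card_Diff_subset, auto)
  moreover have "card ((\<lambda>j. (j, j)) ` {1..N}) = N"
    by (subst card_image) (auto intro: inj_onI)
  ultimately show ?thesis
    by (simp add: card_cartesian_product power2_eq_square)
qed

lemma gap_pos:
  assumes "inj_on a {1..}" "p \<in> index_pairs N"
  shows "gap a p > 0"
  using assms by (auto simp: index_pairs_def gap_def dest: inj_onD)

lemma pair_correlation_eq_sum:
  "pair_correlation a s x N = (\<Sum>p\<in>index_pairs N. indicator (dilated_arc (s / N) (gap a p)) x) / N"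
proof -
  have "dist_nearest_int (frac (x * of_int (a j)) - frac (x * of_int (a k))) = dist_nearest_int (gap a (j, k) * x)" for j k
  proof -
    have "x * of_int (a j) - x * of_int (a k) = gap a (j, k) * x
        \<or> x * of_int (a j) - x * of_int (a k) = - (gap a (j, k) * x)"
      by (auto simp: gap_def algebra_simps abs_if)
    then show ?thesis
      unfolding dist_nearest_int_frac_diff by (metis dist_nearest_int_minus)
  qed
  then have "{(j, k). j \<in> {1..N} \<and> k \<in> {1..N} \<and> j \<noteq> k \<and>
       dist_nearest_int (frac (x * of_int (a j)) - frac (x * of_int (a k))) \<le> s / real N}
     = {p \<in> index_pairs N. x \<in> dilated_arc (s / N) (gap a p)}"
    by (auto simp: index_pairs_def dilated_arc_def)
  moreover have "(\<Sum>p\<in>index_pairs N. indicator (dilated_arc (s / N) (gap a p)) x)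
      = real (card {p \<in> index_pairs N. x \<in> dilated_arc (s / N) (gap a p)})"
  proof -
    have "(\<Sum>p\<in>index_pairs N. indicator (dilated_arc (s / N) (gap a p)) x)
        = (\<Sum>p\<in>{p \<in> index_pairs N. x \<in> dilated_arc (s / N) (gap a p)}. (1::real))"
      by (rule sum.mono_neutral_cong_right) auto
    then show ?thesis by simp
  qed
  ultimately show ?thesis by (simp add: pair_correlation_def)
qed

text \<open>Grouping by value introduces the multiplicities as weights. It is used forwards for the
  GCD sum, and backwards, with f the indicator of equality, to count pairs with equal gaps.\<close>

lemma sum_pairs_by_value:
  fixes f :: "'b \<Rightarrow> 'b \<Rightarrow> real"
  assumes "finite P"
  shows "(\<Sum>p\<in>P. \<Sum>q\<in>P. f (u p) (u q)) =
    (\<Sum>v\<in>u ` P. \<Sum>w\<in>u ` P. real (card {p \<in> P. u p = v}) * real (card {p \<in> P. u p = w}) * f v w)"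
proof -
  have 1: "(\<Sum>p\<in>P. h (u p)) = (\<Sum>v\<in>u ` P. real (card {p \<in> P. u p = v}) * h v)" for h :: "'b \<Rightarrow> real"
    by (subst sum.image_gen[OF assms, of _ u]) (auto intro!: sum.cong)
  have "(\<Sum>p\<in>P. \<Sum>q\<in>P. f (u p) (u q)) = (\<Sum>p\<in>P. \<Sum>w\<in>u ` P. real (card {p \<in> P. u p = w}) * f (u p) w)"
    by (intro sum.cong refl 1)
  also have "\<dots> = (\<Sum>v\<in>u ` P. real (card {p \<in> P. u p = v}) * (\<Sum>w\<in>u ` P. real (card {p \<in> P. u p = w}) * f v w))"
    by (rule 1)
  finally show ?thesis by (simp add: sum_distrib_left mult_ac)
qed

lemma finite_energy_set:
  "finite A \<Longrightarrow> finite {(a, b, c, d). a \<in> A \<and> b \<in> A \<and> c \<in> A \<and> d \<in> A \<and> a + b = c + d}"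
  by (rule finite_subset[of _ "A \<times> A \<times> A \<times> A"]) auto

lemma card_square_le_additive_energy:
  assumes "finite A"
  shows "(card A)\<^sup>2 \<le> additive_energy A"
proof -
  have "(card A)\<^sup>2 = card ((\<lambda>(a, b). (a, b, a, b)) ` (A \<times> A))"
    by (subst card_image) (auto intro!: inj_onI simp: card_cartesian_product power2_eq_square)
  also have "\<dots> \<le> additive_energy A"
    unfolding additive_energy_def using assms by (intro card_mono finite_energy_set) auto
  finally show ?thesis .
qed

text \<open>Equal gaps mean that two differences agree up to sign, and for either sign the relation
  rearranges to an equality of two sums. As \<open>a\<close> is injective, each of the two cases
  injects into the quadruples counted by the energy.\<close>

lemma sum_gap_multiplicity_square_le:
  assumes inj: "inj_on a {1..}"
  shows "(\<Sum>v\<in>gap a ` index_pairs N. (real (card {p \<in> index_pairs N. gap a p = v}))\<^sup>2)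
    \<le> 2 * real (additive_energy (a ` {1..N}))"
proof -
  let ?P = "index_pairs N" and ?A = "a ` {1..N}"
  let ?Q = "{(a, b, c, d). a \<in> ?A \<and> b \<in> ?A \<and> c \<in> ?A \<and> d \<in> ?A \<and> a + b = c + d}"
  let ?S = "{(p, q). p \<in> ?P \<and> q \<in> ?P \<and> gap a p = gap a q}"
  let ?S1 = "{(p, q). p \<in> ?P \<and> q \<in> ?P \<and> a (fst p) + a (snd q) = a (fst q) + a (snd p)}"
  let ?S2 = "{(p, q). p \<in> ?P \<and> q \<in> ?P \<and> a (fst p) + a (fst q) = a (snd p) + a (snd q)}"
  have inj': "a j = a k \<longleftrightarrow> j = k" if "j \<ge> 1" "k \<ge> 1" for j k
    using that inj by (auto simp: inj_on_def)
  have finQ: "finite ?Q" by (rule finite_energy_set) simp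
  have fin: "finite ?S1" "finite ?S2" by (auto intro: finite_subset[of _ "?P \<times> ?P"])
  have "card ?S1 \<le> card ?Q"
  proof (rule card_inj_on_le[of "\<lambda>(p, q). (a (fst p), a (snd q), a (fst q), a (snd p))"])
    show "inj_on (\<lambda>(p, q). (a (fst p), a (snd q), a (fst q), a (snd p))) ?S1"
      by (auto intro!: inj_onI simp: index_pairs_def inj')
  qed (use finQ in \<open>auto simp: index_pairs_def\<close>)
  moreover have "card ?S2 \<le> card ?Q"
  proof (rule card_inj_on_le[of "\<lambda>(p, q). (a (fst p), a (fst q), a (snd p), a (snd q))"])
    show "inj_on (\<lambda>(p, q). (a (fst p), a (fst q), a (snd p), a (snd q))) ?S2"
      by (auto intro!: inj_onI simp: index_pairs_def inj')
  qed (use finQ in \<open>auto simp: index_pairs_def\<close>)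
  moreover have "card ?S \<le> card (?S1 \<union> ?S2)"
    using fin by (intro card_mono) (auto simp: gap_def abs_if split: if_splits)
  moreover have "card (?S1 \<union> ?S2) \<le> card ?S1 + card ?S2" by (rule card_Un_le)
  ultimately have le: "card ?S \<le> 2 * additive_energy ?A"
    unfolding additive_energy_def by linarith
  have "(\<Sum>v\<in>gap a ` ?P. (real (card {p \<in> ?P. gap a p = v}))\<^sup>2)
      = (\<Sum>v\<in>gap a ` ?P. \<Sum>w\<in>gap a ` ?P. real (card {p \<in> ?P. gap a p = v}) * real (card {p \<in> ?P. gap a p = w}) * (if v = w then 1 else 0))"
    by (intro sum.cong refl) (simp add: power2_eq_square if_distrib[where f = "(*) _"] cong: if_cong)
  also have "\<dots> = (\<Sum>p\<in>?P. \<Sum>q\<in>?P. if gap a p = gap a q then 1 else 0)"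
    by (rule sum_pairs_by_value[symmetric]) simp
  also have "\<dots> = (\<Sum>z\<in>?P \<times> ?P. if gap a (fst z) = gap a (snd z) then 1 else 0)"
    by (simp add: sum.cartesian_product')
  also have "\<dots> = (\<Sum>z\<in>?S. 1)"
    by (rule sum.mono_neutral_cong_right) auto
  finally show ?thesis using le by simp
qed

text \<open>The trivial solutions force the energy to be at least N^2, hence 3 - \<epsilon> >= 2.
  This lets an error N^(-1) be absorbed in \<open>eventually_prob_deviation_le\<close> and makes the
  final dimension exponent positive.\<close>

lemma energy_exponent_le_1:
  fixes a :: "nat \<Rightarrow> int"
  assumes inj: "inj_on a {1..}"
    and energy: "(\<lambda>N. real (additive_energy (a ` {1..N}))) \<in> O(\<lambda>N. real N powr (3 - \<epsilon>))"
  shows "\<epsilon> \<le> 1"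
proof (rule ccontr)
  assume "\<not> \<epsilon> \<le> 1"
  then have e: "\<epsilon> > 1" by simp
  obtain C where C: "\<forall>\<^sub>F N in sequentially. norm (real (additive_energy (a ` {1..N}))) \<le> C * norm (real N powr (3 - \<epsilon>))"
    using landau_o.bigE[OF energy] by blast
  have "filterlim (\<lambda>N. real N powr (\<epsilon> - 1)) at_top sequentially"
    using e by real_asymp
  then have "\<forall>\<^sub>F N in sequentially. real N powr (\<epsilon> - 1) > C"
    by (simp add: filterlim_at_top_dense)
  moreover have "\<forall>\<^sub>F N::nat in sequentially. N \<ge> 1" by (rule eventually_ge_at_top)
  ultimately have "\<forall>\<^sub>F N::nat in sequentially. False"
    using C
  proof eventually_elim
    case (elim N)
    have "card (a ` {1..N}) = N"
      by (subst card_image) (auto intro: inj_on_subset[OF inj])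
    then have "real N ^ 2 \<le> real (additive_energy (a ` {1..N}))"
      using card_square_le_additive_energy[of "a ` {1..N}"] by (simp flip: of_nat_power)
    also have "\<dots> \<le> C * real N powr (3 - \<epsilon>)" using elim by simp
    also have "\<dots> < real N powr (\<epsilon> - 1) * real N powr (3 - \<epsilon>)"
      using elim by (intro mult_strict_right_mono) auto
    also have "\<dots> = real N ^ 2" using elim by (simp flip: powr_add)
    finally show False by simp
  qed
  then show False by simp
qed

text \<open>\<open>prob_deviation_le\<close> with \<delta> = s / N and c = \<eta> N / 2 gives a
  constant times the GCD sum over N^3, and the GCD sum is of order at most N^(\<kappa>/2 + 3 -
  \<epsilon>). The other half of \<kappa> absorbs the constants.\<close>

lemma eventually_prob_deviation_le:
  fixes a :: "nat \<Rightarrow> int"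
  assumes inj: "inj_on a {1..}"
    and energy: "(\<lambda>N. real (additive_energy (a ` {1..N}))) \<in> O(\<lambda>N. real N powr (3 - \<epsilon>))"
    and s: "s \<ge> 0" and \<eta>: "\<eta> > 0" and \<kappa>: "\<kappa> > 0"
  shows "\<forall>\<^sub>F N in sequentially.
    measure unit_measure {x \<in> {0..<1}. \<eta> \<le> \<bar>pair_correlation a s x N - 2 * s\<bar>} \<le> real N powr (\<kappa> - \<epsilon>)"
proof -
  interpret prob_space unit_measure by (rule prob_space_unit_measure)
  have eps1: "\<epsilon> \<le> 1" by (rule energy_exponent_le_1[OF inj energy])
  obtain C where C: "C > 0" "\<forall>\<^sub>F N in sequentially. norm (real (additive_energy (a ` {1..N}))) \<le> C * norm (real N powr (3 - \<epsilon>))"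
    using landau_o.bigE[OF energy] by blast
  \<comment> \<open>Here 8 s / \<eta>^2 is 2 s divided by (\<eta>/2)^2, while 2 C comes from the
    energy bound on the squared multiplicities and 1 from the term N^2 of the GCD bound.\<close>
  define D where "D = 8 * s / \<eta>\<^sup>2 * (2 * C + 1)"
  have "\<forall>\<^sub>F N in sequentially. real N powr (\<kappa> / 2) \<ge> D"
  proof -
    have "filterlim (\<lambda>N. real N powr (\<kappa> / 2)) at_top sequentially" using \<kappa> by real_asymp
    then show ?thesis by (simp add: filterlim_at_top)
  qed
  \<comment> \<open>This threshold makes the defect 2 s / N, due to N^2 - N pairs instead of N^2, at
    most \<eta>/2; the next one makes s / N < 1/2.\<close>
  moreover have "\<forall>\<^sub>F N in sequentially. 4 * s / \<eta> \<le> real N"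
    using filterlim_real_sequentially by (simp add: filterlim_at_top)
  moreover have "\<forall>\<^sub>F N in sequentially. 2 * s < real N"
    using filterlim_real_sequentially by (simp add: filterlim_at_top_dense)
  moreover have "\<forall>\<^sub>F N::nat in sequentially. N \<ge> 1" by (rule eventually_ge_at_top)
  moreover have "\<kappa> / 2 > 0" using \<kappa> by simp
  note eventually_gcd_sum_le[OF this]
  ultimately show ?thesis using C(2)
  proof eventually_elim
    case (elim N)
    let ?P = "index_pairs N" and ?V = "gap a ` index_pairs N"
    define r where "r v = real (card {p \<in> ?P. gap a p = v})" for v
    define G where "G = (\<Sum>p\<in>?P. \<Sum>q\<in>?P. real (gcd (gap a p) (gap a q)) / real (max (gap a p) (gap a q)))"
    define X :: "real \<Rightarrow> real" where "X x = (\<Sum>p\<in>?P. indicator (dilated_arc (s / N) (gap a p)) x)" for x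
    have N: "real N \<ge> 1" "N \<ge> 1" using elim by auto
    have cardP: "real (card ?P) = real N ^ 2 - real N"
      using N by (simp add: card_index_pairs of_nat_diff power2_eq_square)
    have G: "G \<le> N powr (\<kappa> / 2) * (2 * (C * N powr (3 - \<epsilon>))) + real N ^ 2"
    proof -
      have "G = (\<Sum>v\<in>?V. \<Sum>w\<in>?V. r v * r w * (real (gcd v w) / real (max v w)))"
        unfolding G_def r_def by (rule sum_pairs_by_value) simp
      also have "\<dots> \<le> N powr (\<kappa> / 2) * (\<Sum>v\<in>?V. (r v)\<^sup>2) + real N ^ 2"
      proof -
        have "\<forall>v\<in>?V. v > 0" using gap_pos[OF inj] by auto
        moreover have "card ?V \<le> N\<^sup>2"
          using card_image_le[OF finite_index_pairs, of "gap a" N] by (simp add: card_index_pairs)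
        moreover have "(\<Sum>v\<in>?V. r v) \<le> real N ^ 2"
        proof -
          have "(\<Sum>v\<in>?V. r v) = real (card ?P)"
            unfolding r_def using sum.image_gen[of ?P "\<lambda>_. 1::real" "gap a"] by simp
          then show ?thesis using cardP by simp
        qed
        ultimately show ?thesis using elim(5) by (auto simp: r_def)
      qed
      also have "(\<Sum>v\<in>?V. (r v)\<^sup>2) \<le> 2 * (C * N powr (3 - \<epsilon>))"
        using sum_gap_multiplicity_square_le[OF inj, of N] elim(6) by (simp add: r_def)
      finally show ?thesis by (simp add: mult_left_mono)
    qed
    have "measure unit_measure {x \<in> {0..<1}. \<eta> \<le> \<bar>pair_correlation a s x N - 2 * s\<bar>}
        \<le> measure unit_measure {x \<in> {0..<1}. \<eta> / 2 * N \<le> \<bar>X x - 2 * (s / N) * card ?P\<bar>}"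
    proof (rule finite_measure_mono)
      show "{x \<in> {0..<1}. \<eta> \<le> \<bar>pair_correlation a s x N - 2 * s\<bar>}
          \<subseteq> {x \<in> {0..<1}. \<eta> / 2 * N \<le> \<bar>X x - 2 * (s / N) * card ?P\<bar>}"
      proof safe
        fix x assume "\<eta> \<le> \<bar>pair_correlation a s x N - 2 * s\<bar>"
        moreover have "pair_correlation a s x N - 2 * s = (X x - 2 * (s / N) * card ?P) / N - 2 * s / N"
          unfolding pair_correlation_eq_sum X_def cardP using N by (simp add: field_simps power2_eq_square)
        moreover have "\<bar>2 * s / N\<bar> \<le> \<eta> / 2"
          using elim(2) N s \<eta> by (simp add: field_simps)
        ultimately have "\<eta> / 2 \<le> \<bar>(X x - 2 * (s / N) * card ?P) / N\<bar>" by linarith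
        then show "\<eta> / 2 * N \<le> \<bar>X x - 2 * (s / N) * card ?P\<bar>"
          using N by (simp add: pos_le_divide_eq)
      qed
      have "X \<in> borel_measurable borel" unfolding X_def by measurable
      note [measurable] = measurable_unit_measure[OF this]
      have "{x \<in> space unit_measure. \<eta> / 2 * N \<le> \<bar>X x - 2 * (s / N) * card ?P\<bar>} \<in> sets unit_measure"
        by measurable
      then show "{x \<in> {0..<1}. \<eta> / 2 * N \<le> \<bar>X x - 2 * (s / N) * card ?P\<bar>} \<in> sets unit_measure"
        by simp
    qed
    also have "\<dots> \<le> 2 * (s / N) * G / (\<eta> / 2 * N)\<^sup>2"
      unfolding G_def X_def using s \<eta> N elim(3) gap_pos[OF inj]
      by (intro prob_deviation_le) (auto simp: field_simps)
    also have "\<dots> \<le> 2 * (s / N) * (N powr (\<kappa> / 2) * (2 * (C * N powr (3 - \<epsilon>))) + real N ^ 2) / (\<eta> / 2 * N)\<^sup>2"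
      using s by (intro divide_right_mono mult_left_mono G zero_le_power2) simp
    also have "\<dots> = 8 * s / \<eta>\<^sup>2 * ((N powr (\<kappa> / 2) * (2 * (C * N powr (3 - \<epsilon>))) + real N ^ 2) / real N ^ 3)"
      using N \<eta> by (simp add: field_simps power2_eq_square power3_eq_cube)
    also have "(N powr (\<kappa> / 2) * (2 * (C * N powr (3 - \<epsilon>))) + real N ^ 2) / real N ^ 3
        = 2 * C * N powr (\<kappa> / 2 - \<epsilon>) + N powr (-1)"
    proof -
      have e: "real N ^ 3 = real N powr 3" "real N ^ 2 = real N powr 2" using N by simp_all
      have "N powr (\<kappa> / 2) * N powr (3 - \<epsilon>) / N powr 3 = N powr (\<kappa> / 2 + (3 - \<epsilon>) - 3)"
        by (simp only: powr_add powr_diff)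
      moreover have "N powr 2 / N powr 3 = N powr (2 - 3)"
        by (simp only: powr_diff)
      moreover have "(N powr (\<kappa> / 2) * (2 * (C * N powr (3 - \<epsilon>))) + N powr 2) / N powr 3
          = 2 * C * (N powr (\<kappa> / 2) * N powr (3 - \<epsilon>) / N powr 3) + N powr 2 / N powr 3"
        by (simp only: add_divide_distrib mult_ac times_divide_eq_right)
      ultimately show ?thesis unfolding e by simp
    qed
    also have "8 * s / \<eta>\<^sup>2 * (2 * C * N powr (\<kappa> / 2 - \<epsilon>) + N powr (-1))
        \<le> 8 * s / \<eta>\<^sup>2 * (2 * C * N powr (\<kappa> / 2 - \<epsilon>) + N powr (\<kappa> / 2 - \<epsilon>))"
      using s N eps1 \<kappa> by (intro mult_left_mono add_left_mono powr_mono) auto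
    also have "\<dots> = D * N powr (\<kappa> / 2 - \<epsilon>)" 
      by (simp add: D_def algebra_simps add_divide_distrib)
    also have "\<dots> \<le> N powr (\<kappa> / 2) * N powr (\<kappa> / 2 - \<epsilon>)"
      using elim(1) by (intro mult_right_mono) auto
    also have "\<dots> = N powr (\<kappa> - \<epsilon>)" by (simp flip: powr_add)
    finally show ?case .
  qed
qed

section \<open>Convergence along a subsequence\<close>

lemma pair_correlation_nonneg: "0 \<le> pair_correlation a s x N"
  by (simp add: pair_correlation_def)

text \<open>Multiplied by N, the pair correlation is a count that grows with the radius s / N and
  with the range of indices.\<close>

lemma pair_correlation_mono:
  assumes "s / N \<le> t / M" "N \<le> M" "N > 0"
  shows "N * pair_correlation a s x N \<le> M * pair_correlation a t x M"
proof -
  have "(\<Sum>p\<in>index_pairs N. indicator (dilated_arc (s / N) (gap a p)) x)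
      \<le> (\<Sum>p\<in>index_pairs N. indicator (dilated_arc (t / M) (gap a p)) x :: real)"
    using assms(1) by (intro sum_mono) (auto simp: dilated_arc_def split: split_indicator)
  also have "\<dots> \<le> (\<Sum>p\<in>index_pairs M. indicator (dilated_arc (t / M) (gap a p)) x)"
    using assms(2) by (intro sum_mono2 finite_index_pairs) (auto simp: index_pairs_def)
  finally show ?thesis using assms by (simp add: pair_correlation_eq_sum)
qed

lemma pair_correlation_add_of_int:
  "pair_correlation a s (x + of_int m) N = pair_correlation a s x N"
proof -
  have "dist_nearest_int ((x + of_int m) * of_int (a j) - (x + of_int m) * of_int (a k))
      = dist_nearest_int (x * of_int (a j) - x * of_int (a k))" for j k
  proof -
    have "(x + of_int m) * of_int (a j) - (x + of_int m) * of_int (a k)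
        = x * of_int (a j) - x * of_int (a k) + of_int (m * (a j - a k))"
      by (simp add: algebra_simps)
    then show ?thesis by (metis dist_nearest_int_add_of_int)
  qed
  then show ?thesis by (simp add: pair_correlation_def)
qed

lemma poissonian_add_of_int:
  "poissonian_pair_correlation a (x + of_int m) \<longleftrightarrow> poissonian_pair_correlation a x"
  by (simp add: poissonian_pair_correlation_def pair_correlation_add_of_int)

text \<open>Every N lies in the block of k, the integer part of its b-th root, and k tends to
  infinity with N.\<close>

lemma eventually_between_powers:
  assumes b: "b > 0" and ev: "\<forall>\<^sub>F k in sequentially. \<forall>N. k ^ b \<le> N \<longrightarrow> N < (k + 1) ^ b \<longrightarrow> Q N"
  shows "\<forall>\<^sub>F N::nat in sequentially. Q N"
proof -
  obtain K where K: "\<And>k N. k \<ge> K \<Longrightarrow> k ^ b \<le> N \<Longrightarrow> N < (k + 1) ^ b \<Longrightarrow> Q N"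
    using ev by (auto simp: eventually_sequentially)
  have "Q N" if N: "N \<ge> K ^ b" for N
  proof -
    have fin: "finite {k. k ^ b \<le> N}"
    proof (rule finite_subset)
      have "k \<le> k ^ b" for k :: nat using b by (cases "k = 0") (auto intro: self_le_power)
      then show "{k. k ^ b \<le> N} \<subseteq> {..N}" by (auto intro: order_trans)
    qed simp
    define k where "k = Max {k. k ^ b \<le> N}"
    have "k \<in> {k. k ^ b \<le> N}" unfolding k_def using N by (intro Max_in fin) auto
    moreover have "k \<ge> K" unfolding k_def using N by (intro Max_ge fin) auto
    moreover have "\<not> (k + 1) ^ b \<le> N"
      using Max_ge[OF fin, of "k + 1"] by (auto simp: k_def)
    ultimately show "Q N" using K[of k N] by auto
  qed
  then show ?thesis by (auto simp: eventually_sequentially)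
qed

text \<open>Consecutive b-th powers have ratio \<rho> tending to 1, so
  \<open>pair_correlation_mono\<close> squeezes the value at N between those at k^b and (k + 1)^b,
  up to \<rho> and slightly changed parameters s. These can be taken rational, which leaves
  countably many limits to establish.\<close>

lemma poissonian_if_subsequence:
  assumes b: "b > 0"
    and lim: "\<And>q. q \<in> \<rat> \<Longrightarrow> q > 0 \<Longrightarrow> (\<lambda>k. pair_correlation a q x (k ^ b)) \<longlonglongrightarrow> 2 * q"
  shows "poissonian_pair_correlation a x"
  unfolding poissonian_pair_correlation_def
proof (intro allI impI)
  fix s :: real assume s: "s \<ge> 0"
  define \<rho> where "\<rho> k = (real (k + 1) / real k) ^ b" for k :: nat
  have \<rho>: "\<rho> \<longlonglongrightarrow> 1"
  proof -
    have "(\<lambda>k. real (k + 1) / real k) \<longlonglongrightarrow> 1" by real_asymp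
    then have "\<rho> \<longlonglongrightarrow> 1 ^ b" unfolding \<rho>_def by (rule tendsto_power)
    then show ?thesis by simp
  qed
  have \<rho>0: "\<rho> k > 0" if "k \<ge> 1" for k using that by (simp add: \<rho>_def)
  have ratio: "real ((k + 1) ^ b) = \<rho> k * real (k ^ b)" if "k \<ge> 1" for k
    using that by (simp add: \<rho>_def power_divide add.commute)
  have k1: "\<forall>\<^sub>F k::nat in sequentially. k \<ge> 1" by (rule eventually_ge_at_top)
  show "pair_correlation a s x \<longlonglongrightarrow> 2 * s"
  proof (rule order_tendstoI)
    fix u assume u: "2 * s < u"
    \<comment> \<open>The strict gaps s < q and 2 q < u leave room for the factor \<rho> in the
      radius and in the count.\<close>
    obtain q where q: "q \<in> \<rat>" "s < q" "q < u / 2"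
      using Rats_dense_in_real[of s "u / 2"] u by auto
    have "(\<lambda>k. pair_correlation a q x ((k + 1) ^ b)) \<longlonglongrightarrow> 2 * q"
      using LIMSEQ_Suc[OF lim[OF q(1)]] q s by simp
    from tendsto_mult[OF \<rho> this] have "(\<lambda>k. \<rho> k * pair_correlation a q x ((k + 1) ^ b)) \<longlonglongrightarrow> 2 * q"
      by simp
    from order_tendstoD(2)[OF this, of u] q
    have ev1: "\<forall>\<^sub>F k in sequentially. \<rho> k * pair_correlation a q x ((k + 1) ^ b) < u" by simp
    have "(\<lambda>k. s * \<rho> k) \<longlonglongrightarrow> s * 1" by (intro tendsto_intros \<rho>)
    from order_tendstoD(2)[OF this, of q] q
    have ev2: "\<forall>\<^sub>F k in sequentially. s * \<rho> k < q" by simp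
    show "\<forall>\<^sub>F N in sequentially. pair_correlation a s x N < u"
    proof (rule eventually_between_powers[OF b])
      show "\<forall>\<^sub>F k in sequentially. \<forall>N. k ^ b \<le> N \<longrightarrow> N < (k + 1) ^ b \<longrightarrow> pair_correlation a s x N < u"
        using ev1 ev2 k1
      proof (eventually_elim, intro allI impI)
        fix k N assume k: "\<rho> k * pair_correlation a q x ((k + 1) ^ b) < u" "s * \<rho> k < q" "1 \<le> k"
          and N: "k ^ b \<le> N" "N < (k + 1) ^ b"
        let ?M = "(k + 1) ^ b"
        have N0: "N > 0" using N(1) k(3) by (metis One_nat_def Suc_le_lessD le_trans one_le_power)
        have MN: "real ?M \<le> \<rho> k * real N"
          unfolding ratio[OF k(3)] using N(1) \<rho>0[OF k(3)] by (intro mult_left_mono of_nat_mono) auto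
        have "s * real ?M \<le> s * (\<rho> k * real N)" using MN s by (rule mult_left_mono)
        also have "\<dots> \<le> q * real N" using k(2) by (simp add: mult_right_mono flip: mult.assoc)
        finally have "s / N \<le> q / ?M" using N0 by (simp add: field_simps)
        then have "N * pair_correlation a s x N \<le> ?M * pair_correlation a q x ?M"
          using N N0 by (intro pair_correlation_mono) auto
        also have "\<dots> \<le> (\<rho> k * real N) * pair_correlation a q x ?M"
          using MN pair_correlation_nonneg by (rule mult_right_mono)
        finally have "pair_correlation a s x N \<le> \<rho> k * pair_correlation a q x ?M"
          using N0 by (simp add: mult_ac)
        with k(1) show "pair_correlation a s x N < u" by linarith
      qed
    qed
  next
    fix u assume u: "u < 2 * s"
    show "\<forall>\<^sub>F N in sequentially. u < pair_correlation a s x N"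
    \<comment> \<open>Negative u is settled by nonnegativity; this includes s = 0, below which there
      is no positive q.\<close>
    proof (cases "u < 0")
      case True
      then show ?thesis using pair_correlation_nonneg by (intro always_eventually) (metis less_le_trans)
    next
      case False
      obtain q where q: "q \<in> \<rat>" "u / 2 < q" "q < s"
        using Rats_dense_in_real[of "u / 2" s] u by auto
      have q0: "q > 0" using False q by linarith
      from tendsto_divide[OF lim[OF q(1) q0] \<rho>]
      have "(\<lambda>k. pair_correlation a q x (k ^ b) / \<rho> k) \<longlonglongrightarrow> 2 * q" by simp
      from order_tendstoD(1)[OF this, of u] q
      have ev1: "\<forall>\<^sub>F k in sequentially. u < pair_correlation a q x (k ^ b) / \<rho> k" by simp
      have "(\<lambda>k. q * \<rho> k) \<longlonglongrightarrow> q * 1" by (intro tendsto_intros \<rho>)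
      from order_tendstoD(2)[OF this, of s] q
      have ev2: "\<forall>\<^sub>F k in sequentially. q * \<rho> k < s" by simp
      show ?thesis
      proof (rule eventually_between_powers[OF b])
        show "\<forall>\<^sub>F k in sequentially. \<forall>N. k ^ b \<le> N \<longrightarrow> N < (k + 1) ^ b \<longrightarrow> u < pair_correlation a s x N"
          using ev1 ev2 k1
        proof (eventually_elim, intro allI impI)
          fix k N assume k: "u < pair_correlation a q x (k ^ b) / \<rho> k" "q * \<rho> k < s" "1 \<le> k"
            and N: "k ^ b \<le> N" "N < (k + 1) ^ b"
          let ?m = "k ^ b"
          have m0: "?m > 0" using k(3) by simp
          have Nm: "real N \<le> \<rho> k * real ?m"
            unfolding ratio[OF k(3), symmetric] using N(2) by (intro of_nat_mono) simp
          have "q * real N \<le> q * (\<rho> k * real ?m)" using Nm q0 by (intro mult_left_mono) auto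
          also have "\<dots> \<le> s * real ?m" using k(2) by (simp add: mult_right_mono flip: mult.assoc)
          finally have "q * real N \<le> s * real ?m" .
          moreover have "real ?m > 0" "real N > 0" using m0 N(1) by linarith+
          ultimately have "q / ?m \<le> s / N" by (subst frac_le_eq) (auto simp: divide_le_0_iff)
          then have "?m * pair_correlation a q x ?m \<le> N * pair_correlation a s x N"
            using N m0 by (intro pair_correlation_mono) auto
          also have "\<dots> \<le> (\<rho> k * real ?m) * pair_correlation a s x N"
            using Nm pair_correlation_nonneg by (rule mult_right_mono)
          finally have "pair_correlation a q x ?m \<le> \<rho> k * pair_correlation a s x N"
            using m0 by (simp add: mult_ac)
          then have "pair_correlation a q x ?m / \<rho> k \<le> pair_correlation a s x N"
            using \<rho>0[OF k(3)] by (simp add: field_simps)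
          with k(1) show "u < pair_correlation a s x N" by linarith
        qed
      qed
    qed
  qed
qed

section \<open>Almost everywhere convergence by Borel-Cantelli\<close>

lemma borel_measurable_pair_correlation [measurable]:
  "(\<lambda>x. pair_correlation a s x N) \<in> borel_measurable borel"
  unfolding pair_correlation_eq_sum by measurable

lemma sets_deviation:
  "{x \<in> {0..<1}. \<eta> \<le> \<bar>pair_correlation a s x N - 2 * s\<bar>} \<in> sets unit_measure"
proof -
  note [measurable] = measurable_unit_measure[OF borel_measurable_pair_correlation]
  have "{x \<in> space unit_measure. \<eta> \<le> \<bar>pair_correlation a s x N - 2 * s\<bar>} \<in> sets unit_measure"
    by measurable
  then show ?thesis by simp
qed

text \<open>With \<kappa> = \<epsilon> - \<gamma>, the saving N^(-\<gamma>) at N = k^b becomes a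
  power of k that decays as fast as desired for large b.\<close>

lemma eventually_prob_deviation_power_le:
  fixes a :: "nat \<Rightarrow> int"
  assumes inj: "inj_on a {1..}" and eps: "\<gamma> < \<epsilon>"
    and energy: "(\<lambda>N. real (additive_energy (a ` {1..N}))) \<in> O(\<lambda>N. real N powr (3 - \<epsilon>))"
    and \<gamma>: "\<gamma> > 0" and s: "s \<ge> 0" and \<eta>: "\<eta> > 0" and b: "b > 0"
  shows "\<forall>\<^sub>F k in sequentially.
    measure unit_measure {x \<in> {0..<1}. \<eta> \<le> \<bar>pair_correlation a s x (k ^ b) - 2 * s\<bar>} \<le> real k powr (- \<gamma> * b)"
proof -
  have lim: "filterlim (\<lambda>k::nat. k ^ b) sequentially sequentially"
    using b by (intro filterlim_subseq) (auto simp: strict_mono_def power_strict_mono)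
  have "\<forall>\<^sub>F N in sequentially. measure unit_measure {x \<in> {0..<1}. \<eta> \<le> \<bar>pair_correlation a s x N - 2 * s\<bar>}
      \<le> real N powr ((\<epsilon> - \<gamma>) - \<epsilon>)"
    using eps by (intro eventually_prob_deviation_le[OF inj energy s \<eta>]) simp
  from eventually_compose_filterlim[OF this lim]
  have "\<forall>\<^sub>F k in sequentially. measure unit_measure {x \<in> {0..<1}. \<eta> \<le> \<bar>pair_correlation a s x (k ^ b) - 2 * s\<bar>}
      \<le> real (k ^ b) powr ((\<epsilon> - \<gamma>) - \<epsilon>)" .
  moreover have "\<forall>\<^sub>F k::nat in sequentially. k \<ge> 1" by (rule eventually_ge_at_top)
  ultimately show ?thesis
  proof eventually_elim
    case (elim k)
    have "real (k ^ b) powr ((\<epsilon> - \<gamma>) - \<epsilon>) = real k powr (- \<gamma> * b)"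
      using elim by (simp add: powr_powr mult.commute flip: powr_realpow)
    with elim show ?case by simp
  qed
qed

lemma AE_poissonian:
  fixes a :: "nat \<Rightarrow> int"
  assumes inj: "inj_on a {1..}" and eps: "\<epsilon> > 0"
    and energy: "(\<lambda>N. real (additive_energy (a ` {1..N}))) \<in> O(\<lambda>N. real N powr (3 - \<epsilon>))"
  shows "AE x in lebesgue. poissonian_pair_correlation a x"
proof -
  interpret prob_space unit_measure by (rule prob_space_unit_measure)
  \<comment> \<open>With \<gamma> = \<epsilon> / 2 this makes the exponent of k smaller than -2, so
    the measures are summable.\<close>
  obtain b :: nat where b: "4 / \<epsilon> < b" using reals_Archimedean2 by blast
  have b0: "b > 0" using b eps by (auto intro!: Nat.gr0I)
  have AE1: "AE x in unit_measure. \<forall>\<^sub>F k in sequentially. \<bar>pair_correlation a q x (k ^ b) - 2 * q\<bar> < \<eta>"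
    if q: "q > 0" and \<eta>: "\<eta> > 0" for q \<eta>
  proof -
    let ?A = "\<lambda>k. {x \<in> {0..<1}. \<eta> \<le> \<bar>pair_correlation a q x (k ^ b) - 2 * q\<bar>}"
    have "summable (\<lambda>k. measure unit_measure (?A k))"
    proof (rule summable_comparison_test_ev)
      have "\<forall>\<^sub>F k in sequentially. measure unit_measure (?A k) \<le> real k powr (- (\<epsilon> / 2) * b)"
        using q \<eta> eps by (intro eventually_prob_deviation_power_le[OF inj _ energy _ _ _ b0]) auto
      moreover have "\<forall>\<^sub>F k::nat in sequentially. k \<ge> 1" by (rule eventually_ge_at_top)
      ultimately show "\<forall>\<^sub>F k in sequentially. norm (measure unit_measure (?A k)) \<le> real k powr (- 2)"
      proof eventually_elim
        case (elim k)
        have "- (\<epsilon> / 2) * b \<le> -2" using b eps by (simp add: field_simps)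
        then have "real k powr (- (\<epsilon> / 2) * b) \<le> real k powr (- 2)"
          using elim by (intro powr_mono) auto
        with elim show ?case by simp
      qed
      show "summable (\<lambda>k. real k powr (- 2))" by (subst summable_real_powr_iff) simp
    qed
    then have "AE x in unit_measure. \<forall>\<^sub>F k in sequentially. x \<in> space unit_measure - ?A k"
      by (intro borel_cantelli_AE1 sets_deviation) (auto simp: emeasure_eq_measure)
    then show ?thesis
      by eventually_elim (auto elim!: eventually_mono)
  qed
  \<comment> \<open>Rational q and tolerances 1 / (n + 1) keep the number of exceptional null sets
    countable.\<close>
  have "AE x in unit_measure. \<forall>q\<in>\<rat> \<inter> {0<..}. \<forall>n::nat. \<forall>\<^sub>F k in sequentially.
      \<bar>pair_correlation a q x (k ^ b) - 2 * q\<bar> < 1 / real (Suc n)"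
    using countable_rat
    by (intro AE_ball_countable' countable_Int1) (auto simp: AE_all_countable intro!: AE1)
  then have "AE x in unit_measure. poissonian_pair_correlation a x"
  proof eventually_elim
    case (elim x)
    show ?case
    proof (rule poissonian_if_subsequence[OF b0])
      fix q :: real assume q: "q \<in> \<rat>" "q > 0"
      show "(\<lambda>k. pair_correlation a q x (k ^ b)) \<longlonglongrightarrow> 2 * q"
      proof (rule tendstoI)
        fix e :: real assume "e > 0"
        then obtain n where "1 / real (Suc n) < e" using nat_approx_posE by blast
        moreover have "\<forall>\<^sub>F k in sequentially. \<bar>pair_correlation a q x (k ^ b) - 2 * q\<bar> < 1 / real (Suc n)"
          using elim q by auto
        ultimately show "\<forall>\<^sub>F k in sequentially. dist (pair_correlation a q x (k ^ b)) (2 * q) < e"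
          by (auto simp: dist_real_def elim!: eventually_mono)
      qed
    qed
  qed
  then have "AE x in lborel. x \<in> {0..<1} \<longrightarrow> poissonian_pair_correlation a x"
    unfolding unit_measure_def by (subst (asm) AE_restrict_space_iff) auto
  then obtain Z where Z: "Z \<in> null_sets lborel" "{x. \<not> (x \<in> {0..<1} \<longrightarrow> poissonian_pair_correlation a x)} \<subseteq> Z"
    by (auto simp: eventually_ae_filter)
  \<comment> \<open>The property has period 1 in x, so the integer translates of one null set cover
    all exceptions.\<close>
  have "(\<Union>m::int. {x. x - of_int m \<in> Z}) \<in> null_sets lborel"
    using Z(1) by (intro null_sets_UN null_sets_translation)
  moreover have "{x. \<not> poissonian_pair_correlation a x} \<subseteq> (\<Union>m::int. {x. x - of_int m \<in> Z})"
  proof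
    fix x assume x: "x \<in> {x. \<not> poissonian_pair_correlation a x}"
    have "x = frac x + of_int \<lfloor>x\<rfloor>" by (simp add: frac_def)
    with x have "\<not> poissonian_pair_correlation a (frac x)"
      by (metis mem_Collect_eq poissonian_add_of_int)
    then have "frac x \<in> Z" using Z(2) by (auto simp: frac_ge_0 frac_lt_1)
    then have "x - of_int \<lfloor>x\<rfloor> \<in> Z" by (simp add: frac_def)
    then show "x \<in> (\<Union>m::int. {x. x - of_int m \<in> Z})" by blast
  qed
  ultimately have "AE x in lborel. poissonian_pair_correlation a x"
    by (intro AE_I') auto
  then show ?thesis by (rule AE_completion)
qed

section \<open>Hausdorff measure zero\<close>

text \<open>Diameters are unrestricted, so this describes Hausdorff content rather than the
  premeasure. For t > 0 vanishing content already gives vanishing measure, see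
  \<open>hausdorff_measure_eq_0\<close>.\<close>

definition covered :: "real \<Rightarrow> real set \<Rightarrow> ennreal \<Rightarrow> bool" where
  "covered t S c \<longleftrightarrow> (\<exists>U :: nat \<Rightarrow> real set. S \<subseteq> (\<Union>i. U i) \<and> (\<forall>i. bounded (U i)) \<and>
     (\<Sum>i. ennreal (diameter_power t (U i))) \<le> c)"

definition hausdorff_null :: "real \<Rightarrow> real set \<Rightarrow> bool" where
  "hausdorff_null t S \<longleftrightarrow> (\<forall>e>0. covered t S (ennreal e))"

lemma covered_mono: "covered t S c \<Longrightarrow> S' \<subseteq> S \<Longrightarrow> c \<le> c' \<Longrightarrow> covered t S' c'"
  unfolding covered_def by (meson order_trans)

lemma hausdorff_null_mono: "hausdorff_null t S \<Longrightarrow> S' \<subseteq> S \<Longrightarrow> hausdorff_null t S'"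
  unfolding hausdorff_null_def using covered_mono by blast

lemma covered_UN:
  assumes "\<And>k. covered t (S k) (c k)"
  shows "covered t (\<Union>k. S k) (\<Sum>k. c k)"
proof -
  have "\<forall>k. \<exists>U :: nat \<Rightarrow> real set. S k \<subseteq> (\<Union>i. U i) \<and> (\<forall>i. bounded (U i)) \<and>
     (\<Sum>i. ennreal (diameter_power t (U i))) \<le> c k"
    using assms by (simp add: covered_def)
  from choice[OF this] obtain U :: "nat \<Rightarrow> nat \<Rightarrow> real set" where
    U: "\<And>k. S k \<subseteq> (\<Union>i. U k i)" "\<And>k i. bounded (U k i)"
      "\<And>k. (\<Sum>i. ennreal (diameter_power t (U k i))) \<le> c k"
    by blast
  define W where "W n = (case prod_decode n of (k, i) \<Rightarrow> U k i)" for n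
  have "(\<Union>k. S k) \<subseteq> (\<Union>n. W n)"
  proof
    fix x assume "x \<in> (\<Union>k. S k)"
    then obtain k i where "x \<in> U k i" using U(1) by blast
    then have "x \<in> W (prod_encode (k, i))" by (simp add: W_def)
    then show "x \<in> (\<Union>n. W n)" by blast
  qed
  moreover have "\<forall>n. bounded (W n)" using U(2) by (simp add: W_def split: prod.split)
  moreover have "(\<Sum>n. ennreal (diameter_power t (W n))) \<le> (\<Sum>k. c k)"
  proof -
    have "(\<Sum>n. ennreal (diameter_power t (W n)))
        = (\<Sum>n. (\<lambda>(k, i). ennreal (diameter_power t (U k i))) (prod_decode n))"
      by (intro suminf_cong) (simp add: W_def split: prod.split)
    also have "\<dots> = (\<Sum>k. \<Sum>i. ennreal (diameter_power t (U k i)))"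
      by (rule suminf_ennreal_2dimen) simp
    also have "\<dots> \<le> (\<Sum>k. c k)" by (intro suminf_le U(3)) auto
    finally show ?thesis .
  qed
  ultimately show ?thesis unfolding covered_def by blast
qed

lemma covered_finite_UN:
  fixes V :: "nat \<Rightarrow> real set" and c :: real
  assumes I: "finite I" and S: "S \<subseteq> (\<Union>i\<in>I. V i)" and bdd: "\<And>i. i \<in> I \<Longrightarrow> bounded (V i)"
    and le: "\<And>i. i \<in> I \<Longrightarrow> diameter_power t (V i) \<le> c"
  shows "covered t S (ennreal (card I * c))"
proof -
  \<comment> \<open>The empty sets that complete the sequence cost 0 for every exponent, by the
    first case of \<open>diameter_power\<close>.\<close>
  define U where "U i = (if i \<in> I then V i else {})" for i
  have "(\<Sum>i. ennreal (diameter_power t (U i))) = (\<Sum>i\<in>I. ennreal (diameter_power t (U i)))"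
    using I by (intro suminf_finite) (auto simp: U_def diameter_power_def)
  also have "\<dots> \<le> (\<Sum>i\<in>I. ennreal c)"
    using le by (intro sum_mono ennreal_leI) (auto simp: U_def)
  also have "\<dots> = of_nat (card I) * ennreal c" by simp
  also have "\<dots> = ennreal (card I * c)"
    by (simp add: ennreal_mult' ennreal_of_nat_eq_real_of_nat)
  finally show ?thesis
    unfolding covered_def using S bdd by (intro exI[of _ U]) (auto simp: U_def)
qed

lemma diameter_translation_real: "diameter ((+) m ` S) = diameter (S :: real set)"
proof (cases "S = {}")
  case False
  have "(\<lambda>(x, y). dist x y) ` ((+) m ` S \<times> (+) m ` S) = (\<lambda>(x, y). dist x y) ` (S \<times> S)"
    by (force simp: image_iff)
  then show ?thesis using False by (simp add: diameter_def)
qed simp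

lemma covered_translation:
  assumes "covered t S c"
  shows "covered t ((+) m ` S) c"
proof -
  obtain U :: "nat \<Rightarrow> real set" where U: "S \<subseteq> (\<Union>i. U i)" "\<And>i. bounded (U i)"
      "(\<Sum>i. ennreal (diameter_power t (U i))) \<le> c"
    using assms by (auto simp: covered_def)
  have "diameter_power t ((+) m ` U i) = diameter_power t (U i)" for i
    unfolding diameter_power_def diameter_translation_real by auto
  then show ?thesis
    unfolding covered_def using U image_mono[OF U(1), of "(+) m"]
    by (intro exI[of _ "\<lambda>i. (+) m ` U i"]) (simp add: bounded_translation image_UN)
qed

lemma hausdorff_null_translation: "hausdorff_null t S \<Longrightarrow> hausdorff_null t ((+) m ` S)"
  unfolding hausdorff_null_def using covered_translation by blast

lemma hausdorff_null_empty: "hausdorff_null t {}"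
  unfolding hausdorff_null_def covered_def by (auto intro!: exI[of _ "\<lambda>_. {}"] simp: diameter_power_def)

lemma hausdorff_null_UN:
  assumes I: "countable I" and null: "\<And>i. i \<in> I \<Longrightarrow> hausdorff_null t (S i)"
  shows "hausdorff_null t (\<Union>i\<in>I. S i)"
proof (cases "I = {}")
  case False
  show ?thesis
    unfolding hausdorff_null_def
  proof (intro allI impI)
    fix e :: real assume e: "e > 0"
    have "covered t (\<Union>k. S (from_nat_into I k)) (\<Sum>k. ennreal (e * (1/2) ^ Suc k))"
      using null[OF from_nat_into[OF False]] e by (intro covered_UN) (auto simp: hausdorff_null_def)
    also have "(\<Sum>k. ennreal (e * (1/2) ^ Suc k)) = ennreal e"
    proof -
      have "(\<lambda>k. e * (1/2) ^ Suc k) sums (e * 1)" by (intro sums_mult power_half_series)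
      then show ?thesis using e by (subst suminf_ennreal_eq) auto
    qed
    also have "(\<Union>k. S (from_nat_into I k)) = (\<Union>i\<in>I. S i)"
      using range_from_nat_into[OF False I] by (metis image_image)
    finally show "covered t (\<Union>i\<in>I. S i) (ennreal e)" .
  qed
qed (simp add: hausdorff_null_empty)

text \<open>For t > 0, a cover of total cost at most \<delta>^t has no piece of diameter above
  \<delta>, as that piece alone would cost more. Cheap covers are therefore automatically
  fine.\<close>

lemma hausdorff_measure_eq_0:
  assumes t: "t > 0" and null: "hausdorff_null t S"
  shows "hausdorff_measure t S = 0"
proof -
  have "hausdorff_premeasure t \<delta> S \<le> 0" if \<delta>: "\<delta> > 0" for \<delta>
  proof (rule ennreal_le_epsilon)
    fix e :: real assume e: "e > 0"
    have "min e (\<delta> powr t) > 0" using e \<delta> by simp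
    with null have "covered t S (ennreal (min e (\<delta> powr t)))" by (simp add: hausdorff_null_def)
    then obtain U :: "nat \<Rightarrow> real set" where U: "S \<subseteq> (\<Union>i. U i)" "\<And>i. bounded (U i)"
        "(\<Sum>i. ennreal (diameter_power t (U i))) \<le> ennreal (min e (\<delta> powr t))"
      by (auto simp: covered_def)
    have "diameter (U i) \<le> \<delta>" for i
    proof (rule ccontr)
      assume "\<not> diameter (U i) \<le> \<delta>"
      then have gt: "\<delta> < diameter (U i)" "U i \<noteq> {}" using \<delta> by auto
      have "ennreal (diameter_power t (U i)) \<le> ennreal (min e (\<delta> powr t))"
        using U(3) sum_le_suminf[of "\<lambda>i. ennreal (diameter_power t (U i))" "{i}"]
        by (auto intro: order_trans)
      then have "diameter_power t (U i) \<le> min e (\<delta> powr t)"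
        using e \<delta> by (subst (asm) ennreal_le_iff) auto
      then have "diameter (U i) powr t \<le> \<delta> powr t" using gt t by (simp add: diameter_power_def)
      moreover have "\<delta> powr t < diameter (U i) powr t" using gt t \<delta> by (intro powr_less_mono2) auto
      ultimately show False by simp
    qed
    then have "hausdorff_premeasure t \<delta> S \<le> (\<Sum>i. ennreal (diameter_power t (U i)))"
      unfolding hausdorff_premeasure_def using U by (intro INF_lower) auto
    also have "\<dots> \<le> ennreal e" using U(3) by (auto elim!: order_trans intro: ennreal_leI)
    finally show "hausdorff_premeasure t \<delta> S \<le> 0 + ennreal e" by simp
  qed
  then have "hausdorff_measure t S \<le> 0" unfolding hausdorff_measure_def by (intro SUP_least) auto
  then show ?thesis by simp
qed

lemma hausdorff_dim_le:
  assumes "t > 0" "hausdorff_null t S"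
  shows "hausdorff_dim S \<le> ereal t"
  unfolding hausdorff_dim_def using assms hausdorff_measure_eq_0 by (intro INF_lower) auto

text \<open>The Borel-Cantelli argument for content: S lies in every tail union of the sets B k, and
  the tails of the series of costs tend to 0.\<close>

lemma hausdorff_null_limsup:
  assumes cov: "\<forall>\<^sub>F k in sequentially. covered t (B k) (ennreal (c k))"
    and c: "summable c" "\<And>k. 0 \<le> c k"
    and S: "\<And>x. x \<in> S \<Longrightarrow> \<exists>\<^sub>F k in sequentially. x \<in> B k"
  shows "hausdorff_null t S"
  unfolding hausdorff_null_def
proof (intro allI impI)
  fix e :: real assume e: "e > 0"
  obtain K0 where K0: "\<And>k. k \<ge> K0 \<Longrightarrow> covered t (B k) (ennreal (c k))"
    using cov by (auto simp: eventually_sequentially)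
  obtain K1 where K1: "\<And>n. n \<ge> K1 \<Longrightarrow> norm (\<Sum>i. c (i + n)) < e"
    using suminf_exist_split[OF e c(1)] by blast
  define K where "K = max K0 K1"
  have "covered t (\<Union>k. B (k + K)) (\<Sum>k. ennreal (c (k + K)))"
    by (intro covered_UN K0) (simp add: K_def)
  moreover have "(\<Sum>k. ennreal (c (k + K))) \<le> ennreal e"
  proof -
    have "(\<Sum>k. ennreal (c (k + K))) = ennreal (\<Sum>k. c (k + K))"
      using c by (intro suminf_ennreal2) (auto simp: summable_iff_shift)
    also have "\<dots> \<le> ennreal e" using K1[of K] by (intro ennreal_leI) (auto simp: K_def)
    finally show ?thesis .
  qed
  moreover have "S \<subseteq> (\<Union>k. B (k + K))"
  proof
    fix x assume "x \<in> S"
    then obtain k where "k \<ge> K" "x \<in> B k"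
      using S[of x] by (auto simp: frequently_sequentially)
    then have "x \<in> B ((k - K) + K)" by simp
    then show "x \<in> (\<Union>k. B (k + K))" by blast
  qed
  ultimately show "covered t S (ennreal e)" using covered_mono by blast
qed

text \<open>Converts a measure bound into a cover. Of the L cells of length 1 / L, those meeting B
  lie in A and are disjoint, so their number is at most L times the measure of A, and each costs at
  most L^(-t).\<close>

lemma covered_by_cells:
  fixes L :: nat
  assumes L: "L > 0" and t: "t > 0" and B: "B \<subseteq> {0..<1}" and A: "A \<in> sets unit_measure"
    and cells: "\<And>x y. x \<in> B \<Longrightarrow> y \<in> {0..<1} \<Longrightarrow> \<bar>x - y\<bar> \<le> 1 / L \<Longrightarrow> y \<in> A"
  shows "covered t B (ennreal (real L powr (1 - t) * measure unit_measure A))"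
proof -
  interpret prob_space unit_measure by (rule prob_space_unit_measure)
  define V where "V i = {real i / L..<(real i + 1) / L}" for i
  define I where "I = {i. i < L \<and> V i \<inter> B \<noteq> {}}"
  have fin: "finite I" by (simp add: I_def)
  have V01: "V i \<subseteq> {0..<1}" if "i < L" for i
  proof
    fix x assume x: "x \<in> V i"
    then have "0 \<le> x" using L by (auto simp: V_def elim: order_trans[rotated])
    have "x < (real i + 1) / L" using x by (simp add: V_def)
    also have "\<dots> \<le> 1" using that L by simp
    finally show "x \<in> {0..<1}" using \<open>0 \<le> x\<close> by simp
  qed
  have setV: "V i \<in> sets unit_measure" "measure unit_measure (V i) = 1 / L" if "i < L" for i
  proof -
    show "V i \<in> sets unit_measure"
      unfolding sets_unit_measure using V01[OF that] by (auto simp: sets_restrict_space_iff V_def)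
    have "measure unit_measure (V i) = measure lborel (V i)"
      unfolding unit_measure_def using V01[OF that] by (intro measure_restrict_space) auto
    also have "\<dots> = 1 / L" using L unfolding V_def
      by (subst measure_lborel_Ico) (auto simp: divide_right_mono diff_divide_distrib[symmetric])
    finally show "measure unit_measure (V i) = 1 / L" .
  qed
  have close: "\<bar>x - y\<bar> \<le> 1 / L" if "x \<in> V i" "y \<in> V i" for x y i
    using that by (auto simp: V_def add_divide_distrib abs_le_iff)
  have VA: "V i \<subseteq> A" if i: "i \<in> I" for i
  proof
    fix y assume y: "y \<in> V i"
    obtain x where x: "x \<in> V i" "x \<in> B" using i unfolding I_def by blast
    show "y \<in> A" using cells[OF x(2) _ close[OF x(1) y]] V01[of i] i y by (auto simp: I_def)
  qed
  have disj: "disjoint_family_on V I"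
    unfolding disjoint_family_on_def
  proof (intro ballI impI)
    have *: "V i \<inter> V j = {}" if "i < j" for i j
    proof -
      have "(real i + 1) / L \<le> real j / L" using that L by (intro divide_right_mono) auto
      then show ?thesis by (auto simp: V_def)
    qed
    fix i j :: nat assume "i \<noteq> j"
    then show "V i \<inter> V j = {}" using *[of i j] *[of j i] by (cases i j rule: linorder_cases) auto
  qed
  have "card I * (1 / L) = (\<Sum>i\<in>I. measure unit_measure (V i))"
    using setV by (simp add: I_def)
  also have "\<dots> = measure unit_measure (\<Union>i\<in>I. V i)"
    using setV fin disj by (intro finite_measure_finite_Union[symmetric]) (auto simp: I_def)
  also have "\<dots> \<le> measure unit_measure A"
    using VA A by (intro finite_measure_mono) auto
  finally have card: "card I \<le> L * measure unit_measure A"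
    using L by (simp add: field_simps)
  have "covered t B (ennreal (card I * (1 / L) powr t))"

  proof (rule covered_finite_UN[OF fin])
    show "B \<subseteq> (\<Union>i\<in>I. V i)"
    proof
      fix x assume x: "x \<in> B"
      then have x01: "0 \<le> x" "x < 1" using B by auto
      define i where "i = nat \<lfloor>x * L\<rfloor>"
      have i: "real i = of_int \<lfloor>x * L\<rfloor>" using x01 by (simp add: i_def)
      have "real i \<le> x * L" "x * L < real i + 1" unfolding i by linarith+
      then have "x \<in> V i" using L by (simp add: V_def field_simps)
      moreover have "x * L < L" using x01 L by simp
      then have "i < L" using \<open>real i \<le> x * L\<close> by linarith
      ultimately show "x \<in> (\<Union>i\<in>I. V i)" using x by (auto simp: I_def)
    qed
    fix i assume i: "i \<in> I"
    show "bounded (V i)" 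
      using V01[of i] i by (intro bounded_subset[OF bounded_closed_interval[of "0::real" 1]]) (force simp: I_def)
    have ne: "V i \<noteq> {}" using i by (auto simp: I_def)
    have "diameter (V i) \<le> 1 / L"
      using ne close by (intro diameter_le) auto
    moreover have "0 \<le> diameter (V i)" by (intro diameter_ge_0 \<open>bounded (V i)\<close>)
    ultimately show "diameter_power t (V i) \<le> (1 / L) powr t"
      using ne t by (simp add: diameter_power_def powr_mono2)
  qed
  moreover have "card I * (1 / L) powr t \<le> real L powr (1 - t) * measure unit_measure A"
  proof -
    have "card I * (1 / L) powr t \<le> (L * measure unit_measure A) * (1 / L) powr t"
      using card by (intro mult_right_mono) auto
    also have "\<dots> = real L powr (1 - t) * measure unit_measure A"
      using L by (simp add: powr_divide powr_diff)
    finally show ?thesis .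
  qed
  ultimately show ?thesis by (meson covered_mono ennreal_leI order_refl)
qed

section \<open>Stability in \<alpha> and the dimension of the exceptional set\<close>

lemma pair_correlation_perturb:
  assumes N: "N > 0" and M: "\<And>j. j \<in> {1..N} \<Longrightarrow> \<bar>real_of_int (a j)\<bar> \<le> M"
    and xy: "2 * M * \<bar>x - y\<bar> \<le> \<theta> / N"
  shows "pair_correlation a s x N \<le> pair_correlation a (s + \<theta>) y N"
proof -
  \<comment> \<open>All gaps are at most 2 M, so passing from x to y moves each multiple by at most
    \<theta> / N, and enlarging s by \<theta> compensates for this.\<close>
  have "y \<in> dilated_arc ((s + \<theta>) / N) (gap a p)" if p: "p \<in> index_pairs N" and x: "x \<in> dilated_arc (s / N) (gap a p)" for p
  proof -
    have "real (gap a p) = \<bar>real_of_int (a (fst p)) - real_of_int (a (snd p))\<bar>" by (simp add: gap_def)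
    also have "\<dots> \<le> 2 * M"
      using M[of "fst p"] M[of "snd p"] p by (auto simp: index_pairs_def)
    finally have "real (gap a p) * \<bar>x - y\<bar> \<le> 2 * M * \<bar>x - y\<bar>" by (intro mult_right_mono) auto
    then have "real (gap a p) * \<bar>x - y\<bar> \<le> \<theta> / N" using xy by linarith
    moreover have "\<bar>real (gap a p) * y - real (gap a p) * x\<bar> = real (gap a p) * \<bar>x - y\<bar>"
      by (simp add: abs_mult abs_minus_commute flip: right_diff_distrib)
    ultimately have "dist_nearest_int (gap a p * y) \<le> s / N + \<theta> / N"
      using x dist_nearest_int_lipschitz[of "gap a p * y" "gap a p * x"] by (simp add: dilated_arc_def)
    then show ?thesis by (simp add: dilated_arc_def add_divide_distrib)
  qed
  then show ?thesis
    unfolding pair_correlation_eq_sum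
    by (intro divide_right_mono sum_mono) (auto split: split_indicator)
qed

text \<open>By stability, a deviation at x forces one of half the size, for s + \<theta> or s -
  \<theta>, at all points of the unit interval within 1 / L of x, with L of order N^(d+1). The
  deviation set at N = k^b thus has a cover of cost of order L^(1-t) N^(-\<gamma>), which the choice
  of b makes at most of order k^(-2).\<close>

lemma hausdorff_null_deviation:
  fixes a :: "nat \<Rightarrow> int"
  assumes inj: "inj_on a {1..}"
    and energy: "(\<lambda>N. real (additive_energy (a ` {1..N}))) \<in> O(\<lambda>N. real N powr (3 - \<epsilon>))"
    and d: "d > 0" and C: "C > 0" "\<And>j. j \<ge> 1 \<Longrightarrow> \<bar>real_of_int (a j)\<bar> \<le> C * real j powr d"
    and t: "0 < t" "t \<le> 1" and \<gamma>: "0 < \<gamma>" "\<gamma> < \<epsilon>"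
    and b: "b > 0" "2 \<le> b * (\<gamma> - (d + 1) * (1 - t))"
    and s: "s > 0" and \<eta>: "\<eta> > 0"
  shows "hausdorff_null t {x \<in> {0..<1}. \<exists>\<^sub>F k in sequentially. \<eta> \<le> \<bar>pair_correlation a s x (k ^ b) - 2 * s\<bar>}"
proof -
  interpret prob_space unit_measure by (rule prob_space_unit_measure)
  \<comment> \<open>The bound \<eta>/4 keeps the change 2 \<theta> of the limit within half of
    \<eta>, and s/2 keeps s - \<theta> positive.\<close>
  define \<theta> where "\<theta> = min (\<eta> / 4) (s / 2)"
  have \<theta>: "0 < \<theta>" "\<theta> \<le> \<eta> / 4" "\<theta> \<le> s / 2" using s \<eta> by (auto simp: \<theta>_def)
  let ?D = "\<lambda>s \<eta> N. {x \<in> {0..<1}. \<eta> \<le> \<bar>pair_correlation a s x N - 2 * s\<bar>}"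
  define A where "A N = ?D (s + \<theta>) (\<eta> / 2) N \<union> ?D (s - \<theta>) (\<eta> / 2) N" for N
  \<comment> \<open>Chosen so that 2 M / L <= \<theta> / N for the bound M = C N^d on the terms up
    to N.\<close>
  define L where "L N = nat \<lceil>2 * C * real N powr (d + 1) / \<theta>\<rceil>" for N :: nat
  \<comment> \<open>The summand 1 absorbs the ceiling in \<open>L\<close>, because N^(d+1) >=
    1.\<close>
  define K where "K = 2 * C / \<theta> + 1"
  have K: "K > 0" using C \<theta> by (simp add: K_def add_pos_pos)
  have setA: "A N \<in> sets unit_measure" for N
    unfolding A_def by (intro sets.Un sets_deviation)
  have cov: "covered t (?D s \<eta> N) (ennreal (real (L N) powr (1 - t) * measure unit_measure (A N)))"
    if N: "N \<ge> 1" for N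
  proof (rule covered_by_cells)
    have pos: "2 * C * real N powr (d + 1) / \<theta> > 0" using C \<theta> N by simp
    then show L0: "L N > 0" by (simp add: L_def)
    have L_ge: "2 * C * real N powr (d + 1) / \<theta> \<le> L N"
      unfolding L_def by (rule real_nat_ceiling_ge)
    show "y \<in> A N" if x: "x \<in> ?D s \<eta> N" and y: "y \<in> {0..<1}" and xy: "\<bar>x - y\<bar> \<le> 1 / L N" for x y
    proof -
      let ?M = "C * real N powr d"
      have M: "\<bar>real_of_int (a j)\<bar> \<le> ?M" if "j \<in> {1..N}" for j
      proof -
        have "\<bar>real_of_int (a j)\<bar> \<le> C * real j powr d" using C(2) that by auto
        also have "\<dots> \<le> ?M" using that C(1) d by (intro mult_left_mono powr_mono2) auto
        finally show ?thesis .
      qed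
      have "2 * ?M * \<bar>x - y\<bar> \<le> 2 * ?M * (1 / L N)"
        using xy C by (intro mult_left_mono) auto
      also have "\<dots> \<le> \<theta> / N"
      proof -
        have "2 * ?M * N \<le> \<theta> * L N"
          using L_ge \<theta> N by (simp add: field_simps powr_add)
        then show ?thesis using L0 N by (simp add: field_simps)
      qed
      finally have close: "2 * ?M * \<bar>x - y\<bar> \<le> \<theta> / N" .
      have up: "pair_correlation a s x N \<le> pair_correlation a (s + \<theta>) y N"
        using N by (intro pair_correlation_perturb[OF _ M close]) auto
      have "pair_correlation a (s - \<theta>) y N \<le> pair_correlation a (s - \<theta> + \<theta>) x N"
        using N close by (intro pair_correlation_perturb[OF _ M]) (auto simp: abs_minus_commute)
      then have low: "pair_correlation a (s - \<theta>) y N \<le> pair_correlation a s x N" by simp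
      have "\<eta> \<le> \<bar>pair_correlation a s x N - 2 * s\<bar>" using x by simp
      \<comment> \<open>An excess at x persists at y for s + \<theta>, a shortfall for s -
        \<theta>.\<close>
      then have "\<eta> / 2 \<le> \<bar>pair_correlation a (s + \<theta>) y N - 2 * (s + \<theta>)\<bar>
          \<or> \<eta> / 2 \<le> \<bar>pair_correlation a (s - \<theta>) y N - 2 * (s - \<theta>)\<bar>"
        using up low \<theta> by argo
      then show "y \<in> A N" using y by (auto simp: A_def)
    qed
  qed (use t setA in auto)
  have "\<forall>\<^sub>F k in sequentially. covered t (?D s \<eta> (k ^ b)) (ennreal (2 * K powr (1 - t) * real k powr (- 2)))"
  proof -
    have "\<forall>\<^sub>F k in sequentially. measure unit_measure (?D (s + \<theta>) (\<eta> / 2) (k ^ b)) \<le> real k powr (- \<gamma> * b)"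
      using \<gamma> \<theta> s \<eta> b by (intro eventually_prob_deviation_power_le[OF inj _ energy]) auto
    moreover have "\<forall>\<^sub>F k in sequentially. measure unit_measure (?D (s - \<theta>) (\<eta> / 2) (k ^ b)) \<le> real k powr (- \<gamma> * b)"
      using \<gamma> \<theta> s \<eta> b by (intro eventually_prob_deviation_power_le[OF inj _ energy]) auto
    moreover have "\<forall>\<^sub>F k::nat in sequentially. k \<ge> 1" by (rule eventually_ge_at_top)
    ultimately show ?thesis
    proof eventually_elim
      case (elim k)
      let ?N = "k ^ b"
      have N: "?N \<ge> 1" using elim(3) by simp
      have "measure unit_measure (A ?N) \<le> 2 * real k powr (- \<gamma> * b)"
        unfolding A_def using elim by (intro order_trans[OF measure_Un_le] sets_deviation) auto
      moreover have "real (L ?N) powr (1 - t) \<le> K powr (1 - t) * real k powr (b * (d + 1) * (1 - t))"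
      proof -
        have Npow: "real ?N powr (d + 1) = real k powr (b * (d + 1))"
          using elim(3) by (simp add: powr_powr flip: powr_realpow)
        have "real (L ?N) \<le> 2 * C * real ?N powr (d + 1) / \<theta> + 1"
          unfolding L_def using C \<theta> by simp
        also have "\<dots> \<le> K * real ?N powr (d + 1)"
        proof -
          have "1 \<le> real ?N" using N by (metis of_nat_1 of_nat_le_iff)
          then have "1 \<le> real ?N powr (d + 1)" using d by (intro ge_one_powr_ge_zero) auto
          then show ?thesis unfolding K_def distrib_right by simp
        qed
        finally have "real (L ?N) powr (1 - t) \<le> (K * real k powr (b * (d + 1))) powr (1 - t)"
          unfolding Npow using t by (intro powr_mono2) auto
        also have "\<dots> = K powr (1 - t) * real k powr (b * (d + 1) * (1 - t))"
          using K by (simp add: powr_mult powr_powr)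
        finally show ?thesis .
      qed
      ultimately have "real (L ?N) powr (1 - t) * measure unit_measure (A ?N)
          \<le> (K powr (1 - t) * real k powr (b * (d + 1) * (1 - t))) * (2 * real k powr (- \<gamma> * b))"
        by (intro mult_mono) auto
      also have "\<dots> = 2 * K powr (1 - t) * real k powr (b * (d + 1) * (1 - t) + - \<gamma> * b)"
        by (simp only: powr_add mult_ac)
      also have "\<dots> \<le> 2 * K powr (1 - t) * real k powr (- 2)"
      proof (intro mult_left_mono powr_mono)
        show "b * (d + 1) * (1 - t) + - \<gamma> * b \<le> - 2" using b(2) by (simp add: algebra_simps)
      qed (use elim(3) in auto)
      finally show ?case
        using cov[OF N] by (rule covered_mono[rotated 2, OF ennreal_leI]) simp
    qed
  qed
  then show ?thesis
  proof (rule hausdorff_null_limsup)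
    have "summable (\<lambda>k. real k powr (- 2))" by (subst summable_real_powr_iff) simp
    then show "summable (\<lambda>k. 2 * K powr (1 - t) * real k powr (- 2))" by (rule summable_mult)
  qed (auto elim!: frequently_rev_mp)
qed

text \<open>The growth condition speaks only of large j; the finitely many earlier terms are
  absorbed by adding their absolute values to the constant, as j^d >= 1.\<close>

lemma polynomial_growth_bound:
  fixes a :: "nat \<Rightarrow> int"
  assumes d: "d > 0" and growth: "(\<lambda>x. real_of_int (a x)) \<in> O(\<lambda>x. real x powr d)"
  obtains C where "C > 0" "\<And>j. j \<ge> 1 \<Longrightarrow> \<bar>real_of_int (a j)\<bar> \<le> C * real j powr d"
proof -
  obtain c where c: "c > 0" "\<forall>\<^sub>F x in sequentially. norm (real_of_int (a x)) \<le> c * norm (real x powr d)"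
    using landau_o.bigE[OF growth] by blast
  then obtain x0 where x0: "\<And>x. x \<ge> x0 \<Longrightarrow> \<bar>real_of_int (a x)\<bar> \<le> c * real x powr d"
    by (auto simp: eventually_sequentially)
  define C where "C = c + (\<Sum>j<x0. \<bar>real_of_int (a j)\<bar>)"
  have sum0: "0 \<le> (\<Sum>j<x0. \<bar>real_of_int (a j)\<bar>)" by (intro sum_nonneg) auto
  show ?thesis
  proof (rule that[of C])
    show "C > 0" unfolding C_def using c(1) sum0 by (rule add_pos_nonneg)
    fix j :: nat assume j: "j \<ge> 1"
    have j1: "real j powr d \<ge> 1" using j d by (intro ge_one_powr_ge_zero) auto
    show "\<bar>real_of_int (a j)\<bar> \<le> C * real j powr d"
    proof (cases "j \<ge> x0")
      case True
      have "c * real j powr d \<le> C * real j powr d" using sum0 by (intro mult_right_mono) (auto simp: C_def)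
      with x0[OF True] show ?thesis by linarith
    next
      case False
      have "\<bar>real_of_int (a j)\<bar> \<le> (\<Sum>j<x0. \<bar>real_of_int (a j)\<bar>)"
        using False by (intro member_le_sum) auto
      also have "\<dots> \<le> C * 1" using c by (simp add: C_def)
      also have "\<dots> \<le> C * real j powr d" using j1 c sum0 by (intro mult_left_mono) (auto simp: C_def)
      finally show ?thesis .
    qed
  qed
qed

lemma hausdorff_null_non_poissonian:
  fixes a :: "nat \<Rightarrow> int"
  assumes inj: "inj_on a {1..}" and eps: "\<epsilon> > 0"
    and energy: "(\<lambda>N. real (additive_energy (a ` {1..N}))) \<in> O(\<lambda>N. real N powr (3 - \<epsilon>))"
    and d: "d > 0" and growth: "(\<lambda>x. real_of_int (a x)) \<in> O(\<lambda>x. real x powr d)"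
    and t: "0 < t" "t \<le> 1" "(d + 1) * (1 - t) < \<epsilon>"
  shows "hausdorff_null t {x. \<not> poissonian_pair_correlation a x}"
proof -
  obtain C where C: "C > 0" "\<And>j. j \<ge> 1 \<Longrightarrow> \<bar>real_of_int (a j)\<bar> \<le> C * real j powr d"
    using polynomial_growth_bound[OF d growth] by blast
  \<comment> \<open>The midpoint leaves room on both sides: \<gamma> < \<epsilon> for the measure
    bound, and a positive gap to (d + 1) (1 - t) that a large b turns into the exponent 2.\<close>
  define \<gamma> where "\<gamma> = ((d + 1) * (1 - t) + \<epsilon>) / 2"
  have nn: "0 \<le> (d + 1) * (1 - t)" using d t by simp
  have \<gamma>: "0 < \<gamma>" "\<gamma> < \<epsilon>" "(d + 1) * (1 - t) < \<gamma>"
    using nn t eps by (auto simp: \<gamma>_def field_simps)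
  obtain b :: nat where b: "2 / (\<gamma> - (d + 1) * (1 - t)) < b" using reals_Archimedean2 by blast
  have b1: "2 \<le> b * (\<gamma> - (d + 1) * (1 - t))" using b \<gamma>(3) by (simp add: pos_divide_less_eq)
  have b0: "b > 0" using b1 by (auto intro!: Nat.gr0I)
  \<comment> \<open>A point of the unit interval outside all these limsup sets has the right limits
    along k^b for every positive rational q, so \<open>poissonian_if_subsequence\<close> applies to
    it.\<close>
  let ?S = "\<lambda>(q, n::nat). {x \<in> {0..<1}. \<exists>\<^sub>F k in sequentially. 1 / Suc n \<le> \<bar>pair_correlation a q x (k ^ b) - 2 * q\<bar>}"
  let ?I = "(\<rat> \<inter> {0<..}) \<times> (UNIV :: nat set)"
  have null: "hausdorff_null t (\<Union>i\<in>?I. ?S i)"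
  proof (rule hausdorff_null_UN)
    show "countable ?I" using countable_rat by (intro countable_SIGMA countable_Int1) auto
    fix i :: "real \<times> nat" assume "i \<in> ?I"
    then obtain q and n :: nat where i: "i = (q, n)" "q > 0" by auto
    then show "hausdorff_null t (?S i)"
      using hausdorff_null_deviation[OF inj energy d C t(1,2) \<gamma>(1,2) b0 b1, of q "1 / Suc n"] by simp
  qed
  have sub: "x \<in> (\<Union>i\<in>?I. ?S i)" if x: "x \<in> {0..<1}" "\<not> poissonian_pair_correlation a x" for x
  proof (rule ccontr)
    assume notin: "x \<notin> (\<Union>i\<in>?I. ?S i)"
    have "poissonian_pair_correlation a x"
    proof (rule poissonian_if_subsequence[OF b0])
      fix q :: real assume q: "q \<in> \<rat>" "q > 0"
      show "(\<lambda>k. pair_correlation a q x (k ^ b)) \<longlonglongrightarrow> 2 * q"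
      proof (rule tendstoI)
        fix e :: real assume "e > 0"
        then obtain n where n: "1 / real (Suc n) < e" using nat_approx_posE by blast
        have "\<not> (\<exists>\<^sub>F k in sequentially. 1 / real (Suc n) \<le> \<bar>pair_correlation a q x (k ^ b) - 2 * q\<bar>)"
          using notin q x by auto
        then have "\<forall>\<^sub>F k in sequentially. \<bar>pair_correlation a q x (k ^ b) - 2 * q\<bar> < 1 / real (Suc n)"
          by (simp add: frequently_def not_le)
        then show "\<forall>\<^sub>F k in sequentially. dist (pair_correlation a q x (k ^ b)) (2 * q) < e"
          using n by (auto simp: dist_real_def elim!: eventually_mono)
      qed
    qed
    with x show False by simp
  qed
  have "hausdorff_null t (\<Union>m\<in>(UNIV :: int set). (+) (of_int m) ` (\<Union>i\<in>?I. ?S i))"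
    by (intro hausdorff_null_UN hausdorff_null_translation null) auto
  then show ?thesis
  proof (rule hausdorff_null_mono)
    show "{x. \<not> poissonian_pair_correlation a x} \<subseteq> (\<Union>m\<in>(UNIV :: int set). (+) (of_int m) ` (\<Union>i\<in>?I. ?S i))"
    proof
      fix x assume x: "x \<in> {x. \<not> poissonian_pair_correlation a x}"
      have e: "x = of_int \<lfloor>x\<rfloor> + frac x" by (simp add: frac_def)
      with x have "\<not> poissonian_pair_correlation a (frac x)"
        by (metis mem_Collect_eq poissonian_add_of_int add.commute)
      then have "frac x \<in> (\<Union>i\<in>?I. ?S i)" using sub[of "frac x"] by (simp add: frac_lt_1)
      then show "x \<in> (\<Union>m\<in>(UNIV :: int set). (+) (of_int m) ` (\<Union>i\<in>?I. ?S i))"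
        using e by blast
    qed
  qed
qed

theorem theorem1:
  fixes a :: "nat \<Rightarrow> int" and \<epsilon> :: real
  assumes distinct: "inj_on a {1..}"
    and eps: "\<epsilon> > 0"
    and energy: "(\<lambda>N. real (additive_energy (a ` {1..N}))) \<in> O(\<lambda>N. real N powr (3 - \<epsilon>))"
  shows "(AE \<alpha> in lebesgue. poissonian_pair_correlation a \<alpha>) \<and>
    (\<forall>d::real. d > 0 \<longrightarrow> (\<lambda>x. real_of_int (a x)) \<in> O(\<lambda>x. real x powr d) \<longrightarrow>
      hausdorff_dim {\<alpha>. \<not> poissonian_pair_correlation a \<alpha>} \<le> ereal ((d + 3 - \<epsilon>) / (d + 3)))"
proof (intro conjI allI impI)
  show "AE \<alpha> in lebesgue. poissonian_pair_correlation a \<alpha>"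
    by (rule AE_poissonian[OF distinct eps energy])
next
  fix d :: real
  assume d: "d > 0" and growth: "(\<lambda>x. real_of_int (a x)) \<in> O(\<lambda>x. real x powr d)"
  define t where "t = (d + 3 - \<epsilon>) / (d + 3)"
  have "\<epsilon> \<le> 1" by (rule energy_exponent_le_1[OF distinct energy])
  then have t: "0 < t" "t \<le> 1" using d eps by (auto simp: t_def)
  \<comment> \<open>\<open>hausdorff_null_non_poissonian\<close> requires t > 1 - \<epsilon> / (d +
    1), while t equals 1 - \<epsilon> / (d + 3), so the strict inequality holds with room to
    spare.\<close>
  have "(d + 1) * (1 - t) = \<epsilon> * ((d + 1) / (d + 3))"
    using d by (simp add: t_def field_simps)
  also have "\<dots> < \<epsilon> * 1" using d eps by (intro mult_strict_left_mono) auto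
  finally have "hausdorff_null t {\<alpha>. \<not> poissonian_pair_correlation a \<alpha>}"
    using t by (intro hausdorff_null_non_poissonian[OF distinct eps energy d growth]) auto
  with t(1) show "hausdorff_dim {\<alpha>. \<not> poissonian_pair_correlation a \<alpha>} \<le> ereal ((d + 3 - \<epsilon>) / (d + 3))"
    unfolding t_def[symmetric] by (rule hausdorff_dim_le)
qed

end
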